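(* Consider the non-stationary $N$-stage decision model with recursive risk measures described in the context. Assume the following. (1) (Continuity and compactness) For $n=0,\dots,N-1$: the sets $D_n(x)$, $x\in E$, are compact and $x\mapsto D_n(x)$ is upper semicontinuous, i.e. if $x_k\to x$ in $E$ and $a_k\in D_n(x_k)$ for $k\in\mathbb N$, then $(a_k)$ has an accumulation point in $D_n(x)$; the function $(x,a)\mapsto T_n(x,a,z)$ is continuous on $D_n$ for every $z\in\mathcal Z$; the one-stage cost functions $c_n:D_n\times E\to\mathbb R$ and the terminal cost function $c_N:E\to\mathbb R$ are lower semicontinuous. (2) (Bounding functions) There exist $\underline\epsilon,\bar\epsilon\ge 0$ with $\underline\epsilon+\bar\epsilon=1$ and measurable functions $\underline{\mathbf b}:E\to(-\infty,-\underline\epsilon]$ and $\bar{\mathbf b}:E\to[\bar\epsilon,\infty)$ such that for all policies $\pi\in\Pi$ and all $n=0,\dots,N$ $$\underline{\mathbf b}(x_n)\le V_{n\pi}(h_n)\le \bar{\mathbf b}(x_n),\qquad h_n\in\mathcal H_n.$$ (3) (Integrable local bounds) Put $\mathbf b=\bar{\mathbf b}-\underline{\mathbf b}:E\to[1,\infty)$. For all $n=0,\dots,N-1$ and $(\bar x,\bar a)\in D_n$ there exist $\epsilon>0$ and measurable functions $\Theta_{n,1}^{\bar x,\bar a},\Theta_{n,2}^{\bar x,\bar a}:\mathcal Z\to\mathbb R_+$ with $\Theta_{n,1}^{\bar x,\bar a}(Z_{n+1}),\Theta_{n,2}^{\bar x,\bar a}(Z_{n+1})\in L^p$ and $$|c_n(x,a,T_n(x,a,z))|\le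 \Theta_{n,1}^{\bar x,\bar a}(z),\qquad \mathbf b(T_n(x,a,z))\le\Theta_{n,2}^{\bar x,\bar a}(z)$$ for all $z\in\mathcal Z$ and all $(x,a)\in D_n$ in the closed ball of radius $\epsilon$ around $(\bar x,\bar a)$ (w.r.t. a product metric on $E\times A$). (4) The monetary risk measures $\rho_0,\dots,\rho_{N-1}:L^p\to\bar{\mathbb R}$ are law invariant and have the Fatou property. Then for $n=0,\dots,N$ the value function $V_n$ depends only on $x_n$, i.e. $V_n(h_n)=J_n(x_n)$ for all $h_n\in\mathcal H_n$; the function $J_n$ is lower semicontinuous and satisfies $\underline{\mathbf b}\le J_n\le\bar{\mathbf b}$ pointwise; and the Bellman equation holds: $$J_N(x)=c_N(x),\qquad J_n(x)=\mathcal T_nJ_{n+1}(x),\quad x\in E,\ n=0,\dots,N-1.$$ Furthermore, for $n=0,\dots,N-1$ there exist Markov decision rules $d_n^*$ with $\mathcal T_nJ_{n+1}=\mathcal T_{n d_n^*}J_{n+1}$, and every sequence of such minimizers constitutes an optimal policy $\pi^*=(d_0^*,\dots,d_{N-1}^* )$, i.e. $V_{0\pi^*}(x)=\inf_{\pi\in\Pi}V_{0\pi}(x)$ for all $x\in E$.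
   Context: Risk measures. Fix a probability space $(\Omega,\mathcal A,\mathbb P)$ and $p\in[1,\infty)$; $L^p=L^p(\Omega,\mathcal A,\mathbb P)$ is the space of real random variables with finite $p$-th moment (positive values are losses). A risk measure is a map $\rho:L^p\to\bar{\mathbb R}=[-\infty,\infty]$. It is monetary if it is monotone ($X\le Y\Rightarrow\rho(X)\le\rho(Y)$) and translation invariant ($\rho(X+m)=\rho(X)+m$ for $m\in\mathbb R$); law invariant if $\rho(X)=\rho(Y)$ whenever $X,Y$ have the same distribution. It has the Fatou property if for every sequence $(X_n)\subseteq L^p$ with $|X_n|\le Y$ $\mathbb P$-a.s. for some $Y\in L^p$ and $X_n\to X\in L^p$ $\mathbb P$-a.s. one has $\liminf_n\rho(X_n)\ge\rho(X)$. Decision model. $N\in\mathbb N$. State space $E$ and action space $A$ are Borel spaces (Borel subsets of Polish spaces). For $n=0,\dots,N-1$: $D_n\subseteq E\times A$ is measurable and contains the graph of a measurable map $E\to A$; $D_n(x)=\{a\in A:(x,a)\in D_n\}$; $T_n:D_n\times\mathcal Z\to E$ is a measurable transition function; $c_n:D_n\times E\to\mathbb R$ is the one-stage cost and $c_N:E\to\mathbb R$ the terminal cost. The disturbances $Z_1,Z_2,\dots$ are independent random elements on $(\Omega,\mathcal A,\mathbb P)$ with values in a measurable space $(\mathcal Z,\mathfrak Z)$. Policies. $\mathcal H_n$ is the set of histories $h_n=(x_0,a_0,x_1,\dots,a_{n-1},x_n)$ with $a_k\in D_k(x_k)$ ($h_0=x_0$). A decision rule at time $n$ is a measurable $d_n:\mathcal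 H_n\to A$ with $d_n(h_n)\in D_n(x_n)$; it is Markov if it depends only on $x_n$. $\Pi$ is the set of policies $\pi=(d_0,\dots,d_{N-1})$, $\Pi^M$ the subset of policies all of whose decision rules are Markov. Values. $V_{N\pi}(h_N)=c_N(x_N)$ and, for $n=N-1,\dots,0$, with $a=d_n(h_n)$, $$V_{n\pi}(h_n)=\rho_n\Big(c_n\big(x_n,a,T_n(x_n,a,Z_{n+1})\big)+V_{n+1\,\pi}\big(h_n,a,T_n(x_n,a,Z_{n+1})\big)\Big).$$ It is assumed throughout that the risk measures are such that all policy values $V_{n\pi}$ are measurable functions. Value functions: $V_n(h_n)=\inf_{\pi\in\Pi}V_{n\pi}(h_n)$. For $\pi\in\Pi^M$, $V_{n\pi}(h_n)$ depends on $x_n$ only and is denoted $J_{n\pi}(x_n)$; $J_n(x)=\inf_{\pi\in\Pi^M}J_{n\pi}(x)$ (so $J_N=c_N$). Operators. Given measurable $v:E\to\mathbb R$ with $|v|\le\lambda\mathbf b$ for some $\lambda\in\mathbb R_+$ and a Markov decision rule $d$: $L_nv(x,a)=\rho_n\big(c_n(x,a,T_n(x,a,Z_{n+1}))+v(T_n(x,a,Z_{n+1}))\big)$ for $(x,a)\in D_n$, $\mathcal T_{nd}v(x)=L_nv(x,d(x))$, $\mathcal T_nv(x)=\inf_{a\in D_n(x)}L_nv(x,a)$. *)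

theory Defs
  imports "HOL-Probability.Probability"
begin

text \<open>
  Lower semicontinuity of \<open>f\<close> on \<open>S\<close> in the subspace topology, for real as well as
  extended real values: \<open>f x \<le> liminf f y\<close> as \<open>y\<close> tends to \<open>x\<close> within \<open>S\<close>.
\<close>

definition lsc_on :: "'x::topological_space set \<Rightarrow> ('x \<Rightarrow> 'y::linorder) \<Rightarrow> bool" where
  "lsc_on S f \<longleftrightarrow> (\<forall>x\<in>S. \<forall>r<f x. \<forall>\<^sub>F y in at x within S. r < f y)"

definition accumulation_point :: "(nat \<Rightarrow> 'x::topological_space) \<Rightarrow> 'x \<Rightarrow> bool" where
  "accumulation_point u l \<longleftrightarrow> (\<forall>U. open U \<longrightarrow> l \<in> U \<longrightarrow> (\<exists>\<^sub>F k in sequentially. u k \<in> U))"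


section \<open>Risk measures\<close>

text \<open>
  Random variables are not identified when they agree almost surely. In exchange, the order is
  the almost sure one, so that monotone functionals respect the identification. Values of
  \<open>\<rho>\<close> outside \<open>Lp P p\<close> are irrelevant.
\<close>

definition Lp :: "'w measure \<Rightarrow> real \<Rightarrow> ('w \<Rightarrow> real) set" where
  "Lp P p = {X \<in> borel_measurable P. integrable P (\<lambda>\<omega>. \<bar>X \<omega>\<bar> powr p)}"

definition monetary :: "'w measure \<Rightarrow> real \<Rightarrow> (('w \<Rightarrow> real) \<Rightarrow> ereal) \<Rightarrow> bool" where
  "monetary P p \<rho> \<longleftrightarrow>
     (\<forall>X\<in>Lp P p. \<forall>Y\<in>Lp P p. (AE \<omega> in P. X \<omega> \<le> Y \<omega>) \<longrightarrow> \<rho> X \<le> \<rho> Y) \<and>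
     (\<forall>X\<in>Lp P p. \<forall>m::real. \<rho> (\<lambda>\<omega>. X \<omega> + m) = \<rho> X + ereal m)"

definition law_invariant :: "'w measure \<Rightarrow> real \<Rightarrow> (('w \<Rightarrow> real) \<Rightarrow> ereal) \<Rightarrow> bool" where
  "law_invariant P p \<rho> \<longleftrightarrow>
     (\<forall>X\<in>Lp P p. \<forall>Y\<in>Lp P p. distr P borel X = distr P borel Y \<longrightarrow> \<rho> X = \<rho> Y)"

definition fatou_property :: "'w measure \<Rightarrow> real \<Rightarrow> (('w \<Rightarrow> real) \<Rightarrow> ereal) \<Rightarrow> bool" where
  "fatou_property P p \<rho> \<longleftrightarrow>
     (\<forall>Xs X Y. (\<forall>k. Xs k \<in> Lp P p) \<longrightarrow> X \<in> Lp P p \<longrightarrow> Y \<in> Lp P p \<longrightarrow>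
        (\<forall>k. AE \<omega> in P. \<bar>Xs k \<omega>\<bar> \<le> Y \<omega>) \<longrightarrow>
        (AE \<omega> in P. (\<lambda>k. Xs k \<omega>) \<longlonglongrightarrow> X \<omega>) \<longrightarrow>
        \<rho> X \<le> liminf (\<lambda>k. \<rho> (Xs k)))"


section \<open>The decision model\<close>

text \<open>
  The field \<open>Zsp\<close> only contributes its sigma algebra. The model functions are total; only
  their values on the domains occurring in \<open>decision_model\<close> matter.
\<close>

record ('w, 'e, 'a, 'z) model =
  Pr :: "'w measure"
  expo :: real
  horizon :: nat
  St :: "'e set"
  Act :: "'a set"
  Adm :: "nat \<Rightarrow> ('e \<times> 'a) set"
  Zsp :: "'z measure"
  dist_rv :: "nat \<Rightarrow> 'w \<Rightarrow> 'z"
  trans_fun :: "nat \<Rightarrow> 'e \<Rightarrow> 'a \<Rightarrow> 'z \<Rightarrow> 'e"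
  cost :: "nat \<Rightarrow> 'e \<Rightarrow> 'a \<Rightarrow> 'e \<Rightarrow> real"
  tcost :: "'e \<Rightarrow> real"
  risk :: "nat \<Rightarrow> ('w \<Rightarrow> real) \<Rightarrow> ereal"

definition adm :: "('w, 'e, 'a, 'z) model \<Rightarrow> nat \<Rightarrow> 'e \<Rightarrow> 'a set" where
  "adm \<M> n x = {a. (x, a) \<in> Adm \<M> n}"

text \<open>
  The Borel spaces are Borel subsets of types of class \<open>polish_space\<close>, carrying the subspace
  topology.
\<close>

definition decision_model ::
    "('w, 'e::polish_space, 'a::polish_space, 'z) model \<Rightarrow> bool" where
  "decision_model \<M> \<longleftrightarrow>
     prob_space (Pr \<M>) \<and> 1 \<le> expo \<M> \<and>
     St \<M> \<in> sets borel \<and> Act \<M> \<in> sets borel \<and>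
     (\<forall>n<horizon \<M>.
        Adm \<M> n \<in> sets borel \<and> Adm \<M> n \<subseteq> St \<M> \<times> Act \<M> \<and>
        (\<exists>f \<in> restrict_space borel (St \<M>) \<rightarrow>\<^sub>M restrict_space borel (Act \<M>).
            \<forall>x\<in>St \<M>. (x, f x) \<in> Adm \<M> n) \<and>
        (\<lambda>((x, a), z). trans_fun \<M> n x a z)
          \<in> restrict_space borel (Adm \<M> n) \<Otimes>\<^sub>M Zsp \<M> \<rightarrow>\<^sub>M restrict_space borel (St \<M>)) \<and>
     prob_space.indep_vars (Pr \<M>) (\<lambda>_. Zsp \<M>) (dist_rv \<M>) {1..}"


subsection \<open>Histories and policies\<close>

text \<open>
  A history \<open>(x\<^sub>0, a\<^sub>0, x\<^sub>1, \<dots>, a\<^bsub>n-1\<^esub>, x\<^sub>n)\<close> is the pair of the extensional families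
  \<open>(x\<^sub>k)\<close>, \<open>k \<le> n\<close>, and \<open>(a\<^sub>k)\<close>, \<open>k < n\<close>.
\<close>

type_synonym ('e, 'a) hist = "(nat \<Rightarrow> 'e) \<times> (nat \<Rightarrow> 'a)"

definition last_state :: "nat \<Rightarrow> ('e, 'a) hist \<Rightarrow> 'e" where
  "last_state n h = fst h n"

definition extend_hist :: "nat \<Rightarrow> ('e, 'a) hist \<Rightarrow> 'a \<Rightarrow> 'e \<Rightarrow> ('e, 'a) hist" where
  "extend_hist n h a y = ((fst h)(Suc n := y), (snd h)(n := a))"

definition init_hist :: "'e \<Rightarrow> ('e, 'a) hist" where
  "init_hist x = (restrict (\<lambda>_. x) {..0}, restrict (\<lambda>_. undefined) {..<0})"

definition histories :: "('w, 'e, 'a, 'z) model \<Rightarrow> nat \<Rightarrow> ('e, 'a) hist set" where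
  "histories \<M> n =
     {h \<in> (\<Pi>\<^sub>E k\<in>{..n}. St \<M>) \<times> (\<Pi>\<^sub>E k\<in>{..<n}. Act \<M>).
        \<forall>k<n. snd h k \<in> adm \<M> k (fst h k)}"

definition hist_space ::
    "('w, 'e::polish_space, 'a::polish_space, 'z) model \<Rightarrow> nat \<Rightarrow> ('e, 'a) hist measure" where
  "hist_space \<M> n =
     restrict_space
       ((\<Pi>\<^sub>M k\<in>{..n}. restrict_space borel (St \<M>)) \<Otimes>\<^sub>M (\<Pi>\<^sub>M k\<in>{..<n}. restrict_space borel (Act \<M>)))
       (histories \<M> n)"

definition policies ::
    "('w, 'e::polish_space, 'a::polish_space, 'z) model \<Rightarrow> (nat \<Rightarrow> ('e, 'a) hist \<Rightarrow> 'a) set" where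
  "policies \<M> =
     {\<pi>. \<forall>n<horizon \<M>.
        \<pi> n \<in> hist_space \<M> n \<rightarrow>\<^sub>M restrict_space borel (Act \<M>) \<and>
        (\<forall>h\<in>histories \<M> n. \<pi> n h \<in> adm \<M> n (last_state n h))}"

definition markov_policies ::
    "('w, 'e::polish_space, 'a::polish_space, 'z) model \<Rightarrow> (nat \<Rightarrow> ('e, 'a) hist \<Rightarrow> 'a) set" where
  "markov_policies \<M> =
     {\<pi> \<in> policies \<M>. \<forall>n<horizon \<M>. \<exists>d. \<forall>h\<in>histories \<M> n. \<pi> n h = d (last_state n h)}"

text \<open>Markov decision rules as functions of the state, and the policies built from them.\<close>

definition markov_rules ::
    "('w, 'e::polish_space, 'a::polish_space, 'z) model \<Rightarrow> nat \<Rightarrow> ('e \<Rightarrow> 'a) set" where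
  "markov_rules \<M> n =
     {d \<in> restrict_space borel (St \<M>) \<rightarrow>\<^sub>M restrict_space borel (Act \<M>).
        \<forall>x\<in>St \<M>. d x \<in> adm \<M> n x}"

definition markov_policy :: "(nat \<Rightarrow> 'e \<Rightarrow> 'a) \<Rightarrow> nat \<Rightarrow> ('e, 'a) hist \<Rightarrow> 'a" where
  "markov_policy d n h = d n (last_state n h)"


subsection \<open>Values\<close>

text \<open>
  Policy values are extended real because the risk measures are. The next-stage value is cast to
  a real number to form the argument of \<open>risk\<close>, an element of \<open>Lp\<close>; this changes
  nothing as long as policy values are finite. For \<open>n > horizon \<M>\<close> the value is junk.
\<close>

function pol_value ::
    "('w, 'e, 'a, 'z) model \<Rightarrow> (nat \<Rightarrow> ('e, 'a) hist \<Rightarrow> 'a) \<Rightarrow> nat \<Rightarrow> ('e, 'a) hist \<Rightarrow> ereal" where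
  "pol_value \<M> \<pi> n h =
     (if horizon \<M> \<le> n then ereal (tcost \<M> (last_state n h))
      else risk \<M> n (\<lambda>\<omega>.
        let x = last_state n h; a = \<pi> n h; y = trans_fun \<M> n x a (dist_rv \<M> (Suc n) \<omega>)
        in cost \<M> n x a y + real_of_ereal (pol_value \<M> \<pi> (Suc n) (extend_hist n h a y))))"
  by pat_completeness auto
termination
  by (relation "Wellfounded.measure (\<lambda>(\<M>, \<pi>, n, h). horizon \<M> - n)") auto

declare pol_value.simps [simp del]

definition value_fun ::
    "('w, 'e::polish_space, 'a::polish_space, 'z) model \<Rightarrow> nat \<Rightarrow> ('e, 'a) hist \<Rightarrow> ereal" where
  "value_fun \<M> n h = (INF \<pi>\<in>policies \<M>. pol_value \<M> \<pi> n h)"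

text \<open>
  For a Markov policy, \<open>pol_value\<close> is the same for all histories ending in \<open>x\<close>; such
  histories exist for every state \<open>x\<close>, since every \<open>Adm \<M> k\<close> contains a graph.
\<close>

definition markov_value ::
    "('w, 'e, 'a, 'z) model \<Rightarrow> (nat \<Rightarrow> ('e, 'a) hist \<Rightarrow> 'a) \<Rightarrow> nat \<Rightarrow> 'e \<Rightarrow> ereal" where
  "markov_value \<M> \<pi> n x =
     pol_value \<M> \<pi> n (SOME h. h \<in> histories \<M> n \<and> last_state n h = x)"

definition J :: "('w, 'e::polish_space, 'a::polish_space, 'z) model \<Rightarrow> nat \<Rightarrow> 'e \<Rightarrow> ereal" where
  "J \<M> n x = (INF \<pi>\<in>markov_policies \<M>. markov_value \<M> \<pi> n x)"


subsection \<open>Operators\<close>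

definition L_op ::
    "('w, 'e, 'a, 'z) model \<Rightarrow> nat \<Rightarrow> ('e \<Rightarrow> real) \<Rightarrow> 'e \<Rightarrow> 'a \<Rightarrow> ereal" where
  "L_op \<M> n v x a =
     risk \<M> n (\<lambda>\<omega>. let y = trans_fun \<M> n x a (dist_rv \<M> (Suc n) \<omega>) in cost \<M> n x a y + v y)"

definition T_rule ::
    "('w, 'e, 'a, 'z) model \<Rightarrow> nat \<Rightarrow> ('e \<Rightarrow> 'a) \<Rightarrow> ('e \<Rightarrow> real) \<Rightarrow> 'e \<Rightarrow> ereal" where
  "T_rule \<M> n d v x = L_op \<M> n v x (d x)"

definition T_op :: "('w, 'e, 'a, 'z) model \<Rightarrow> nat \<Rightarrow> ('e \<Rightarrow> real) \<Rightarrow> 'e \<Rightarrow> ereal" where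
  "T_op \<M> n v x = (INF a\<in>adm \<M> n x. L_op \<M> n v x a)"

text \<open>\<open>J\<close> as an argument of the operators, which act on real functions.\<close>

definition J_real ::
    "('w, 'e::polish_space, 'a::polish_space, 'z) model \<Rightarrow> nat \<Rightarrow> 'e \<Rightarrow> real" where
  "J_real \<M> n x = real_of_ereal (J \<M> n x)"

end

theory Submission
  imports Defs
begin

text \<open>
  Backward induction. If \<open>v = J\<^bsub>n+1\<^esub>\<close> is lower semicontinuous, then the limit inferior of
  \<open>c\<^sub>n + v\<close> along converging state-action pairs dominates its value at the limit; since
  everything is locally dominated in \<open>L\<^sup>p\<close>, the Fatou property and monotonicity turn
  this into lower semicontinuity of \<open>L\<^sub>n v\<close>. Minimizing over the compact, upper semicontinuous
  sets \<open>D\<^sub>n(x)\<close> preserves it. The sets of minimizers are compact, and they hit a closed set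
  \<open>C\<close> exactly if the infimum over \<open>D\<^sub>n(x) \<inter> C\<close>, again lower semicontinuous in \<open>x\<close>, equals the full
  infimum; hence they depend measurably on \<open>x\<close> and admit a measurable selector. Monotonicity
  gives \<open>V\<^bsub>n\<pi>\<^esub>(h\<^sub>n) \<ge> T\<^sub>n J\<^bsub>n+1\<^esub>(x\<^sub>n)\<close> for every policy, with equality along the selectors.
\<close>

section \<open>Lower semicontinuity and measurable selection\<close>

text \<open>The filter in \<open>lsc_on\<close> omits the point \<open>x\<close> itself; there the
  bound holds by assumption, so a full neighbourhood is available.\<close>

lemma lsc_onD:
  assumes "lsc_on S f" "x \<in> S" "r < f x"
  obtains U where "open U" "x \<in> U" "\<And>y. y \<in> U \<Longrightarrow> y \<in> S \<Longrightarrow> r < f y"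
proof -
  from assms have "\<forall>\<^sub>F y in at x within S. r < f y"
    by (auto simp: lsc_on_def)
  then obtain U where "open U" "x \<in> U" "\<And>y. y \<in> U \<Longrightarrow> y \<noteq> x \<Longrightarrow> y \<in> S \<Longrightarrow> r < f y"
    by (auto simp: eventually_at_topological)
  with assms(3) that show thesis
    by metis
qed

lemma lsc_on_eventually_sequentially:
  assumes "lsc_on S f" "x \<in> S" "r < f x" "xs \<longlonglongrightarrow> x" "\<And>k. xs k \<in> S"
  shows "\<forall>\<^sub>F k in sequentially. r < f (xs k)"
proof -
  obtain U where U: "open U" "x \<in> U" "\<And>y. y \<in> U \<Longrightarrow> y \<in> S \<Longrightarrow> r < f y"
    using lsc_onD[OF assms(1-3)] by blast
  have "\<forall>\<^sub>F k in sequentially. xs k \<in> U"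
    using assms(4) U by (simp add: tendsto_def)
  then show ?thesis
    by eventually_elim (use U assms(5) in auto)
qed

lemma lsc_on_cong:
  assumes "\<And>x. x \<in> S \<Longrightarrow> f x = g x"
  shows "lsc_on S f \<longleftrightarrow> lsc_on S g"
proof -
  have "(\<forall>\<^sub>F y in at x within S. r < f y) \<longleftrightarrow> (\<forall>\<^sub>F y in at x within S. r < g y)" for x r
    using assms by (auto simp: eventually_at_topological)
  then show ?thesis
    using assms by (auto simp: lsc_on_def)
qed

text \<open>Strict superlevel sets are relatively open, being traces of the union \<open>V\<close>
  of all suitable open sets. The value type stays general because the lemma serves real costs as
  well as extended real infima.\<close>

lemma borel_measurable_lsc_on:
  fixes f :: "'x::topological_space \<Rightarrow> 'y::{linorder_topology, second_countable_topology}"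
  assumes "lsc_on S f"
  shows "f \<in> borel_measurable (restrict_space borel S)"
proof (rule borel_measurableI_greater)
  fix r
  define V where "V = \<Union>{U. open U \<and> (\<forall>y\<in>U \<inter> S. r < f y)}"
  have "{x \<in> S. r < f x} = S \<inter> V"
  proof (intro equalityI subsetI)
    fix x assume "x \<in> {x \<in> S. r < f x}"
    then obtain U where "open U" "x \<in> U" "\<And>y. y \<in> U \<Longrightarrow> y \<in> S \<Longrightarrow> r < f y" "x \<in> S"
      using lsc_onD[OF assms, of x r] by blast
    then show "x \<in> S \<inter> V"
      unfolding V_def by blast
  qed (auto simp: V_def)
  moreover have "open V"
    by (auto simp: V_def)
  ultimately show "{x \<in> space (restrict_space borel S). r < f x} \<in> sets (restrict_space borel S)"
    by (auto simp: space_restrict_space sets_restrict_space)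
qed

lemma accumulation_point_closed:
  assumes "accumulation_point u l" "closed C" "\<And>k. u k \<in> C"
  shows "l \<in> C"
proof (rule ccontr)
  assume "l \<notin> C"
  then have "\<exists>\<^sub>F k in sequentially. u k \<in> - C"
    using assms(1,2) by (auto simp: accumulation_point_def)
  with assms(3) show False
    by simp
qed

section \<open>Minimization over upper semicontinuous sets of actions\<close>

locale usc_graph =
  fixes S :: "'x::metric_space set" and D :: "('x \<times> 'a::polish_space) set"
  assumes usc: "\<And>xs x as. (\<And>k. xs k \<in> S) \<Longrightarrow> x \<in> S \<Longrightarrow> xs \<longlonglongrightarrow> x \<Longrightarrow>
      (\<And>k. (xs k, as k) \<in> D) \<Longrightarrow> \<exists>a. (x, a) \<in> D \<and> accumulation_point as a"
begin

text \<open>An accumulation point is only known to be approached infinitely often. If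
  \<open>f (x, a)\<close> exceeded \<open>r\<close>, lower semicontinuity would give a product
  neighbourhood on which \<open>f\<close> exceeds \<open>r\<close>; the states are in it eventually
  and the actions frequently, hence both at some index where the bound by \<open>r\<close> holds as
  well. The closed constraint \<open>C\<close> survives the passage to the limit.\<close>

lemma accumulation_le:
  assumes f: "lsc_on D f" and C: "closed C"
    and xs: "\<And>k. xs k \<in> S" "x \<in> S" "xs \<longlonglongrightarrow> x" and as: "\<And>k. (xs k, as k) \<in> D" "\<And>k. as k \<in> C"
  obtains a where "(x, a) \<in> D" "a \<in> C"
    "\<And>r. \<forall>\<^sub>F k in sequentially. f (xs k, as k) \<le> r \<Longrightarrow> f (x, a) \<le> r"
proof -
  obtain a where a: "(x, a) \<in> D" "accumulation_point as a"
    using usc[OF xs as(1)] by blast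
  have "f (x, a) \<le> r" if r: "\<forall>\<^sub>F k in sequentially. f (xs k, as k) \<le> r" for r
  proof (rule ccontr)
    assume "\<not> f (x, a) \<le> r"
    then obtain W where W: "open W" "(x, a) \<in> W" "\<And>y. y \<in> W \<Longrightarrow> y \<in> D \<Longrightarrow> r < f y"
      using lsc_onD[OF f a(1), of r] by (auto simp: not_le)
    then obtain U V where UV: "open U" "open V" "x \<in> U" "a \<in> V" "U \<times> V \<subseteq> W"
      by (auto elim: open_prod_elim)
    have "\<forall>\<^sub>F k in sequentially. xs k \<in> U"
      using xs(3) UV by (simp add: tendsto_def)
    with r have "\<forall>\<^sub>F k in sequentially. as k \<in> V \<longrightarrow> as k \<in> V \<and> xs k \<in> U \<and> f (xs k, as k) \<le> r"
      by eventually_elim simp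
    moreover have "\<exists>\<^sub>F k in sequentially. as k \<in> V"
      using a(2) UV by (simp add: accumulation_point_def)
    ultimately have "\<exists>\<^sub>F k in sequentially. as k \<in> V \<and> xs k \<in> U \<and> f (xs k, as k) \<le> r"
      by (rule frequently_rev_mp[rotated])
    then obtain k where k: "as k \<in> V" "xs k \<in> U" "f (xs k, as k) \<le> r"
      using frequently_ex by blast
    then have "(xs k, as k) \<in> W"
      using UV(5) by blast
    with W(3)[of "(xs k, as k)"] as(1)[of k] k(3) show False
      by simp
  qed
  with a(1) accumulation_point_closed[OF a(2) C as(2)] show thesis
    by (rule that)
qed

text \<open>Near-minimizers along a sequence violating lower semicontinuity accumulate at an action
  that is too cheap for the limit state. Since the infimum over the empty set is \<infinity>, states
  without an action in \<open>C\<close> are included. General closed \<open>C\<close> is what the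
  measurability of the minimizers requires later; \<open>C = UNIV\<close> gives the plain
  infimum.\<close>

lemma lsc_on_INF:
  fixes f :: "'x \<times> 'a \<Rightarrow> ereal"
  assumes f: "lsc_on D f" and C: "closed C"
  shows "lsc_on S (\<lambda>x. INF a\<in>{a. (x, a) \<in> D \<and> a \<in> C}. f (x, a))" (is "lsc_on S ?g")
  unfolding lsc_on_def
proof (intro ballI allI impI)
  fix x r assume x: "x \<in> S" and "r < ?g x"
  \<comment> \<open>The gap between \<open>r\<close> and \<open>r'\<close> allows near-minimizers to
    be chosen without attaining the infimum; the gap above \<open>r'\<close> yields the
    contradiction.\<close>
  then obtain r' where r': "r < r'" "r' < ?g x"
    using dense by blast
  show "\<forall>\<^sub>F y in at x within S. r < ?g y"
  proof (rule sequentially_imp_eventually_within, intro allI impI, rule ccontr)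
    fix ys assume ys: "(\<forall>n. ys n \<in> S \<and> ys n \<noteq> x) \<and> ys \<longlonglongrightarrow> x"
      and "\<not> (\<forall>\<^sub>F n in sequentially. r < ?g (ys n))"
    then have "\<exists>\<^sub>F n in sequentially. ?g (ys n) \<le> r"
      by (simp add: frequently_def not_le)
    then have "infinite {n. ?g (ys n) \<le> r}"
      by (simp add: frequently_sequentially infinite_nat_iff_unbounded_le)
    then obtain \<phi> :: "nat \<Rightarrow> nat" where \<phi>: "strict_mono \<phi>" "\<And>k. ?g (ys (\<phi> k)) \<le> r"
      using infinite_enumerate by blast
    have "\<exists>a. (ys (\<phi> k), a) \<in> D \<and> a \<in> C \<and> f (ys (\<phi> k), a) < r'" for k
      using le_less_trans[OF \<phi>(2)[of k] r'(1)] by (auto simp: INF_less_iff)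
    then obtain as where as: "\<And>k. (ys (\<phi> k), as k) \<in> D" "\<And>k. as k \<in> C" "\<And>k. f (ys (\<phi> k), as k) < r'"
      by metis
    have "(ys \<circ> \<phi>) \<longlonglongrightarrow> x"
      using ys \<phi>(1) LIMSEQ_subseq_LIMSEQ by blast
    then obtain a where "(x, a) \<in> D" "a \<in> C" and
      "\<And>r. \<forall>\<^sub>F k in sequentially. f (ys (\<phi> k), as k) \<le> r \<Longrightarrow> f (x, a) \<le> r"
      using accumulation_le[OF f C, of "ys \<circ> \<phi>" x as] as x ys by auto
    moreover have "f (ys (\<phi> k), as k) \<le> r'" for k
      using as(3)[of k] by simp
    ultimately have "?g x \<le> r'"
      by (intro INF_lower2[of a]) auto
    with r' show False
      by simp
  qed
qed

text \<open>Upper semicontinuity along the constant sequence \<open>x\<close> gives an accumulation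
  point of a minimizing sequence, and \<open>accumulation_le\<close> makes it a minimizer.\<close>

lemma INF_attained:
  fixes f :: "'x \<times> 'a \<Rightarrow> ereal"
  assumes f: "lsc_on D f" and C: "closed C" and x: "x \<in> S" and ne: "(x, a) \<in> D" "a \<in> C"
  obtains a where "(x, a) \<in> D" "a \<in> C" "f (x, a) = (INF a\<in>{a. (x, a) \<in> D \<and> a \<in> C}. f (x, a))"
proof -
  let ?I = "INF a\<in>{a. (x, a) \<in> D \<and> a \<in> C}. f (x, a)"
  obtain u where u: "range u \<subseteq> f ` ({x} \<times> {a. (x, a) \<in> D \<and> a \<in> C})" "u \<longlonglongrightarrow> ?I"
    using Inf_as_limit[of "(\<lambda>a. f (x, a)) ` {a. (x, a) \<in> D \<and> a \<in> C}"] ne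
    by (auto simp: image_iff subset_iff)
  then have "\<exists>a. (x, a) \<in> D \<and> a \<in> C \<and> u k = f (x, a)" for k
    by auto
  then obtain as where as: "\<And>k. (x, as k) \<in> D" "\<And>k. as k \<in> C" "\<And>k. u k = f (x, as k)"
    by metis
  obtain a where a: "(x, a) \<in> D" "a \<in> C"
      "\<And>r. \<forall>\<^sub>F k in sequentially. f (x, as k) \<le> r \<Longrightarrow> f (x, a) \<le> r"
    using accumulation_le[OF f C, of "\<lambda>_. x" x as] as x by auto
  have "f (x, a) \<le> r" if "?I < r" for r
    using order_tendstoD(2)[OF u(2) that] as(3) by (auto intro!: a(3) elim: eventually_mono)
  then have "f (x, a) \<le> ?I"
    by (rule dense_ge)
  moreover have "?I \<le> f (x, a)"
    using a by (intro INF_lower) auto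
  ultimately show thesis
    using that a by (simp add: antisym)
qed

end

section \<open>Measurable selection from compact sets\<close>

lemma decreasing_compact_Inter_nonempty:
  fixes K :: "nat \<Rightarrow> 'a::t2_space set"
  assumes "\<And>j. compact (K j)" "\<And>j. K j \<noteq> {}" "\<And>j. K (Suc j) \<subseteq> K j"
  shows "(\<Inter>j. K j) \<noteq> {}"
proof -
  have anti: "K j \<subseteq> K i" if "i \<le> j" for i j
    by (rule lift_Suc_antimono_le[of K]) (use that assms(3) in auto)
  have "K 0 \<inter> (\<Inter>j\<in>UNIV. K j) \<noteq> {}"
  proof (rule compact_imp_fip_image)
    fix I :: "nat set" assume "finite I"
    \<comment> \<open>A finite intersection contains the member with the largest index. Inserting 0
      covers empty \<open>I\<close> and the extra factor \<open>K 0\<close>.\<close>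
    then have "K (Max (insert 0 I)) \<subseteq> K 0 \<inter> (\<Inter>j\<in>I. K j)"
      by (intro Int_greatest INT_greatest anti Max_ge) auto
    with assms(2) show "K 0 \<inter> (\<Inter>j\<in>I. K j) \<noteq> {}"
      by blast
  qed (use assms(1) in \<open>auto intro: compact_imp_closed\<close>)
  then show ?thesis
    by blast
qed

text \<open>
  A compact-valued case of the Kuratowski--Ryll-Nardzewski theorem: the values are cut down by
  balls of radius \<open>2\<^sup>-\<^sup>j\<close> around the first suitable point of a dense sequence, until a
  single point is left.
\<close>

lemma compact_measurable_selection:
  fixes K :: "'x \<Rightarrow> 'a::polish_space set"
  assumes compact: "\<And>x. x \<in> space M \<Longrightarrow> compact (K x)"
    and nonempty: "\<And>x. x \<in> space M \<Longrightarrow> K x \<noteq> {}"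
    and hits: "\<And>C. closed C \<Longrightarrow> {x \<in> space M. K x \<inter> C \<noteq> {}} \<in> sets M"
  obtains s where "s \<in> borel_measurable M" "\<And>x. x \<in> space M \<Longrightarrow> s x \<in> K x"
proof -
  obtain Q :: "'a set" where Q: "countable Q" "\<And>X. open X \<Longrightarrow> X \<noteq> {} \<Longrightarrow> \<exists>d\<in>Q. d \<in> X"
    using countable_dense_exists by blast
  define q where "q = from_nat_into Q"
  have "Q \<noteq> {}"
    using Q(2)[of UNIV] by auto
  then have range_q: "range q = Q"
    using Q(1) by (simp add: q_def)
  have dense: "\<exists>i. y \<in> cball (q i) r" if "0 < r" for y r
  proof -
    have "\<exists>d\<in>Q. d \<in> ball y r"
      by (rule Q(2)) (use that in auto)
    then show ?thesis
      unfolding range_q[symmetric] by (auto simp: dist_commute intro: less_imp_le)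
  qed
  define r :: "nat \<Rightarrow> real" where "r j = (1/2)^j" for j
  have r: "0 < r j" for j
    by (simp add: r_def)
  \<comment> \<open>Closed balls keep the sets compact and match \<open>hits\<close>, which speaks
    of closed sets only. Through the least index, the chosen ball depends only on which balls are
    hit.\<close>
  define cut where "cut j B = B \<inter> cball (q (LEAST i. B \<inter> cball (q i) (r j) \<noteq> {})) (r j)" for j B
  define L where "L x = rec_nat (K x) cut" for x
  have L_0: "L x 0 = K x" and L_Suc: "L x (Suc j) = cut j (L x j)" for x j
    by (simp_all add: L_def)
  have cut: "cut j B \<noteq> {}" if "B \<noteq> {}" for j B
  proof -
    from that obtain y i where "y \<in> B" "y \<in> cball (q i) (r j)"
      using dense[OF r] by blast
    then have "\<exists>i. B \<inter> cball (q i) (r j) \<noteq> {}"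
      by blast
    then show ?thesis
      unfolding cut_def by (rule LeastI_ex)
  qed
  have L_ne: "L x j \<noteq> {}" if "x \<in> space M" for x j
    by (induction j) (simp_all add: L_0 L_Suc nonempty that cut)
  have L_compact: "compact (L x j)" if "x \<in> space M" for x j
    by (induction j) (auto simp: L_0 L_Suc compact that cut_def intro!: compact_Int_closed)
  \<comment> \<open>Stated for all closed \<open>C\<close> at once, since stage \<open>Suc j\<close>
    uses stage \<open>j\<close> for \<open>C\<close> intersected with balls. The event is split by
    the index \<open>i\<close> of the first ball hit; for fixed \<open>i\<close>, the cut set meets
    \<open>C\<close> iff the previous one meets that ball within \<open>C\<close>.\<close>
  have L_hits: "{x \<in> space M. L x j \<inter> C \<noteq> {}} \<in> sets M" if "closed C" for j C
    using that
  proof (induction j arbitrary: C)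
    case 0
    then show ?case by (simp add: L_0 hits)
  next
    case (Suc j)
    let ?H = "\<lambda>C. {x \<in> space M. L x j \<inter> C \<noteq> {}}"
    let ?B = "\<lambda>i. cball (q i) (r j)"
    have "{x \<in> space M. L x (Suc j) \<inter> C \<noteq> {}} =
      (\<Union>i. (?H (?B i \<inter> C) \<inter> ?H (?B i)) - (\<Union>i'<i. ?H (?B i')))" (is "?l = ?r")
    proof (intro equalityI subsetI)
      fix x assume x: "x \<in> ?l"
      define i where "i = (LEAST i. L x j \<inter> ?B i \<noteq> {})"
      from x have "L x j \<inter> (?B i \<inter> C) \<noteq> {}"
        by (simp add: L_Suc cut_def i_def Int_assoc)
      then have "x \<in> ?H (?B i \<inter> C)" "x \<in> ?H (?B i)"
        using x by blast+
      moreover have "L x j \<inter> ?B i' = {}" if "i' < i" for i'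
        using not_less_Least[OF that[unfolded i_def]] by blast
      ultimately show "x \<in> ?r"
        by blast
    next
      fix x assume "x \<in> ?r"
      then obtain i where i: "x \<in> ?H (?B i \<inter> C)" "x \<in> ?H (?B i)" "\<And>i'. i' < i \<Longrightarrow> x \<notin> ?H (?B i')"
        by blast
      have "(LEAST i. L x j \<inter> ?B i \<noteq> {}) = i"
      proof (rule Least_equality)
        show "i \<le> i'" if "L x j \<inter> ?B i' \<noteq> {}" for i'
          using i(1) i(3)[of i'] that by (cases "i' < i") auto
      qed (use i(2) in simp)
      with i(1) show "x \<in> ?l"
        by (simp add: L_Suc cut_def Int_assoc)
    qed
    also have "\<dots> \<in> sets M"
      by (intro sets.countable_UN sets.Diff sets.Int sets.finite_UN Suc.IH image_subsetI)
        (use Suc.prems in auto)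
    finally show ?case .
  qed
  define s where "s x = (SOME a. a \<in> (\<Inter>j. L x j))" for x
  have s: "s x \<in> L x j" if "x \<in> space M" for x j
  proof -
    have "(\<Inter>j. L x j) \<noteq> {}"
      using L_ne L_compact that
      by (intro decreasing_compact_Inter_nonempty) (auto simp: L_Suc cut_def)
    then show ?thesis
      unfolding s_def some_in_eq[symmetric] by blast
  qed
  \<comment> \<open>Membership of the selected point in a closed set is expressed by countably many
    hitting events. If all stages meet \<open>C\<close>, compactness gives a common point
    \<open>b\<close> in \<open>C\<close>; the shrinking balls contain both \<open>b\<close> and
    \<open>s x\<close>, so they coincide.\<close>
  have s_iff: "s x \<in> C \<longleftrightarrow> (\<forall>j. L x j \<inter> C \<noteq> {})" if x: "x \<in> space M" and C: "closed C" for x C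
  proof
    assume "\<forall>j. L x j \<inter> C \<noteq> {}"
    then have "(\<Inter>j. L x j \<inter> C) \<noteq> {}"
      using L_compact[OF x] C
      by (intro decreasing_compact_Inter_nonempty compact_Int_closed) (auto simp: L_Suc cut_def)
    then obtain b where b: "\<And>j. b \<in> L x j" "b \<in> C"
      by blast
    have "dist (s x) b \<le> 2 * r j" for j
    proof -
      \<comment> \<open>Stage \<open>Suc j\<close> is the first one lying in a ball of radius
        \<open>r j\<close>; stage 0 is not cut at all.\<close>
      obtain i where "s x \<in> cball (q i) (r j)" "b \<in> cball (q i) (r j)"
        using s[OF x, of "Suc j"] b(1)[of "Suc j"] unfolding L_Suc cut_def by blast
      then show ?thesis
        using dist_triangle2[of "s x" b "q i"] by (simp add: dist_commute)
    qed
    moreover have "(\<lambda>j. 2 * r j) \<longlonglongrightarrow> 2 * 0"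
      unfolding r_def by (intro tendsto_intros LIMSEQ_power_zero) auto
    ultimately have "dist (s x) b \<le> 2 * 0"
      by (intro LIMSEQ_le_const[of "\<lambda>j. 2 * r j"]) auto
    with b show "s x \<in> C"
      by simp
  qed (use s[OF x] in blast)
  have "s \<in> borel_measurable M"
  proof (rule borel_measurableI)
    fix U :: "'a set" assume "open U"
    then have "{x \<in> space M. s x \<in> - U} = space M \<inter> (\<Inter>j. {x \<in> space M. L x j \<inter> - U \<noteq> {}})"
      using s_iff[of _ "- U"] by (auto simp del: ComplI Compl_iff)
    also have "\<dots> \<in> sets M"
      using L_hits[of "- U"] \<open>open U\<close> by (intro sets.Int sets.countable_INT) auto
    finally have "space M - {x \<in> space M. s x \<in> - U} \<in> sets M"
      by auto
    also have "space M - {x \<in> space M. s x \<in> - U} = s -` U \<inter> space M"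
      by auto
    finally show "s -` U \<inter> space M \<in> sets M" .
  qed
  moreover have "s x \<in> K x" if "x \<in> space M" for x
    using s[OF that, of 0] by (simp add: L_0)
  ultimately show thesis
    by (rule that)
qed

lemma (in usc_graph) measurable_minimizer:
  fixes f :: "'x \<times> 'a \<Rightarrow> ereal"
  assumes f: "lsc_on D f" and compact: "\<And>x. x \<in> S \<Longrightarrow> compact {a. (x, a) \<in> D}"
    and nonempty: "\<And>x. x \<in> S \<Longrightarrow> {a. (x, a) \<in> D} \<noteq> {}"
  obtains s where "s \<in> borel_measurable (restrict_space borel S)" "\<And>x. x \<in> S \<Longrightarrow> (x, s x) \<in> D"
    "\<And>x. x \<in> S \<Longrightarrow> f (x, s x) = (INF a\<in>{a. (x, a) \<in> D}. f (x, a))"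
proof -
  let ?M = "restrict_space borel S"
  define G where "G f C x = (INF a\<in>{a. (x, a) \<in> D \<and> a \<in> C}. f (x, a))"
    for f :: "'x \<times> 'a \<Rightarrow> ereal" and C x
  define K where "K x = {a. (x, a) \<in> D \<and> f (x, a) \<le> G f UNIV x}" for x
  have G_meas [measurable]: "G f C \<in> borel_measurable ?M" if "lsc_on D f" "closed C" for f C
    using borel_measurable_lsc_on[OF lsc_on_INF[OF that]] by (simp add: G_def[abs_def])
  \<comment> \<open>The infimum of the zero function over the actions in \<open>C\<close> is 0 or
    \<infinity> according to whether there are any, so \<open>lsc_on_INF\<close> also yields
    measurability of this nonemptiness. The test is essential where \<open>f (x, a)\<close> is
    \<infinity> for all admissible \<open>a\<close>: there both infima of \<open>f\<close> agree
    even if \<open>C\<close> is missed.\<close>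
  have lsc_zero: "lsc_on D (\<lambda>_. 0 :: ereal)"
    by (simp add: lsc_on_def)
  obtain s where s: "s \<in> borel_measurable ?M" "\<And>x. x \<in> space ?M \<Longrightarrow> s x \<in> K x"
  proof (rule compact_measurable_selection[of ?M K])
    fix x assume "x \<in> space ?M"
    then have x: "x \<in> S"
      by (simp add: space_restrict_space)
    then obtain a where "(x, a) \<in> D"
      using nonempty by blast
    then obtain a where "(x, a) \<in> D" "f (x, a) = G f UNIV x"
      using INF_attained[OF f closed_UNIV x, of a] unfolding G_def by blast
    then have "a \<in> K x"
      by (simp add: K_def)
    then show "K x \<noteq> {}"
      by blast
    have "closed (K x)"
      unfolding closed_sequential_limits
    proof (intro allI impI)
      fix as l assume l: "(\<forall>k. as k \<in> K x) \<and> as \<longlonglongrightarrow> l"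
      then have "closed {a. (x, a) \<in> D}"
        using compact[OF x] compact_imp_closed by blast
      then have "(x, l) \<in> D"
        using l unfolding closed_sequential_limits K_def by blast
      moreover have "f (x, l) \<le> G f UNIV x"
      proof (rule ccontr)
        assume "\<not> f (x, l) \<le> G f UNIV x"
        then have "\<forall>\<^sub>F k in sequentially. G f UNIV x < f (x, as k)"
          using l \<open>(x, l) \<in> D\<close>
          by (intro lsc_on_eventually_sequentially[OF f, of "(x, l)"]) (auto simp: K_def intro: tendsto_Pair)
        then have "\<forall>\<^sub>F k in sequentially. False"
          by eventually_elim (use l in \<open>auto simp: K_def not_le[symmetric]\<close>)
        then show False
          by simp
      qed
      ultimately show "l \<in> K x"
        by (simp add: K_def)
    qed
    moreover have "K x = {a. (x, a) \<in> D} \<inter> K x"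
      by (auto simp: K_def)
    ultimately show "compact (K x)"
      using compact[OF x] by (metis compact_Int_closed)
  next
    fix C :: "'a set" assume C: "closed C"
    have "{x \<in> space ?M. K x \<inter> C \<noteq> {}} =
      {x \<in> space ?M. G (\<lambda>_. 0) C x < \<infinity> \<and> G f C x \<le> G f UNIV x}"
    proof (intro Collect_cong conj_cong refl)
      fix x assume "x \<in> space ?M"
      then have x: "x \<in> S"
        by (simp add: space_restrict_space)
      have "G (\<lambda>_. 0) C x < \<infinity> \<longleftrightarrow> (\<exists>a. (x, a) \<in> D \<and> a \<in> C)"
        unfolding G_def INF_less_iff by auto
      moreover have "K x \<inter> C \<noteq> {} \<longleftrightarrow> (\<exists>a. (x, a) \<in> D \<and> a \<in> C) \<and> G f C x \<le> G f UNIV x"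
      proof
        assume "K x \<inter> C \<noteq> {}"
        then obtain a where a: "(x, a) \<in> D" "a \<in> C" "f (x, a) \<le> G f UNIV x"
          by (auto simp: K_def)
        moreover have "G f C x \<le> f (x, a)"
          using a unfolding G_def by (intro INF_lower) auto
        ultimately show "(\<exists>a. (x, a) \<in> D \<and> a \<in> C) \<and> G f C x \<le> G f UNIV x"
          by auto
      next
        assume *: "(\<exists>a. (x, a) \<in> D \<and> a \<in> C) \<and> G f C x \<le> G f UNIV x"
        then obtain a' where "(x, a') \<in> D" "a' \<in> C"
          by blast
        then obtain a where "(x, a) \<in> D" "a \<in> C" "f (x, a) = G f C x"
          using INF_attained[OF f C x, of a'] unfolding G_def by blast
        with * show "K x \<inter> C \<noteq> {}"
          by (auto simp: K_def)
      qed
      ultimately show "K x \<inter> C \<noteq> {} \<longleftrightarrow> G (\<lambda>_. 0) C x < \<infinity> \<and> G f C x \<le> G f UNIV x"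
        by simp
    qed
    also have "\<dots> \<in> sets ?M"
      using G_meas[OF lsc_zero C] G_meas[OF f C] G_meas[OF f closed_UNIV] by measurable
    finally show "{x \<in> space ?M. K x \<inter> C \<noteq> {}} \<in> sets ?M" .
  qed (rule that)
  have s_D: "(x, s x) \<in> D" and le: "f (x, s x) \<le> G f UNIV x" if "x \<in> S" for x
    using s(2)[of x] that by (auto simp: K_def space_restrict_space)
  have "G f UNIV x \<le> f (x, s x)" if "x \<in> S" for x
    unfolding G_def by (rule INF_lower) (simp add: s_D that)
  with le have "f (x, s x) = (INF a\<in>{a. (x, a) \<in> D}. f (x, a))" if "x \<in> S" for x
    using antisym[of "f (x, s x)" "G f UNIV x"] that by (simp add: G_def)
  with s(1) s_D show thesis
    by (rule that)
qed

text \<open>Mediates between \<open>J\<close>, which is extended real valued, and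
  \<open>J_real\<close>, on which the operators act. The only infinite threshold below a real value
  is -\<infinity>, for which nothing is to be shown.\<close>

lemma lsc_on_ereal_iff: "lsc_on S (\<lambda>x. ereal (f x)) \<longleftrightarrow> lsc_on S f"
proof
  assume *: "lsc_on S (\<lambda>x. ereal (f x))"
  show "lsc_on S f"
    unfolding lsc_on_def
  proof (intro ballI allI impI)
    fix x r assume "x \<in> S" "r < f x"
    then have "\<forall>\<^sub>F y in at x within S. ereal r < ereal (f y)"
      using * unfolding lsc_on_def by (metis less_ereal.simps(1))
    then show "\<forall>\<^sub>F y in at x within S. r < f y"
      by simp
  qed
next
  assume *: "lsc_on S f"
  show "lsc_on S (\<lambda>x. ereal (f x))"
    unfolding lsc_on_def
  proof (intro ballI allI impI)
    fix x r assume "x \<in> S" "r < ereal (f x)"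
    then show "\<forall>\<^sub>F y in at x within S. r < ereal (f y)"
      using * by (cases r) (auto simp: lsc_on_def)
  qed
qed

section \<open>Risk measures\<close>

lemma Lp_dominated:
  assumes "Y \<in> Lp P p" "X \<in> borel_measurable P" "0 \<le> p" "\<And>\<omega>. \<omega> \<in> space P \<Longrightarrow> \<bar>X \<omega>\<bar> \<le> Y \<omega>"
  shows "X \<in> Lp P p"
proof -
  have "integrable P (\<lambda>\<omega>. \<bar>X \<omega>\<bar> powr p)"
  proof (rule Bochner_Integration.integrable_bound)
    show "integrable P (\<lambda>\<omega>. \<bar>Y \<omega>\<bar> powr p)"
      using assms(1) by (simp add: Lp_def)
    show "(\<lambda>\<omega>. \<bar>X \<omega>\<bar> powr p) \<in> borel_measurable P"
      using assms(2) by measurable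
    show "AE \<omega> in P. norm (\<bar>X \<omega>\<bar> powr p) \<le> norm (\<bar>Y \<omega>\<bar> powr p)"
    proof (rule AE_I2)
      fix \<omega> assume "\<omega> \<in> space P"
      then have "\<bar>X \<omega>\<bar> \<le> \<bar>Y \<omega>\<bar>"
        using assms(4)[of \<omega>] by linarith
      then show "norm (\<bar>X \<omega>\<bar> powr p) \<le> norm (\<bar>Y \<omega>\<bar> powr p)"
        using assms(3) by (simp add: powr_mono2)
    qed
  qed
  with assms(2) show ?thesis
    by (simp add: Lp_def)
qed

lemma Lp_add:
  assumes "X \<in> Lp P p" "Y \<in> Lp P p" "0 \<le> p"
  shows "(\<lambda>\<omega>. X \<omega> + Y \<omega>) \<in> Lp P p"
proof -
  have [measurable]: "X \<in> borel_measurable P" "Y \<in> borel_measurable P"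
    using assms by (auto simp: Lp_def)
  \<comment> \<open>The sum is at most twice the larger summand in absolute value, and the power of
    a maximum is at most the sum of the powers.\<close>
  have le: "\<bar>a + b\<bar> powr p \<le> 2 powr p * (\<bar>a\<bar> powr p + \<bar>b\<bar> powr p)" for a b :: real
  proof -
    have "\<bar>a + b\<bar> powr p \<le> (2 * max \<bar>a\<bar> \<bar>b\<bar>) powr p"
      by (rule powr_mono2) (use assms(3) in auto)
    also have "\<dots> = 2 powr p * max \<bar>a\<bar> \<bar>b\<bar> powr p"
      by (simp add: powr_mult)
    also have "max \<bar>a\<bar> \<bar>b\<bar> powr p \<le> \<bar>a\<bar> powr p + \<bar>b\<bar> powr p"
      by (simp add: max_def)
    finally show ?thesis
      by simp
  qed
  have "integrable P (\<lambda>\<omega>. \<bar>X \<omega> + Y \<omega>\<bar> powr p)"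
  proof (rule Bochner_Integration.integrable_bound)
    show "integrable P (\<lambda>\<omega>. 2 powr p * (\<bar>X \<omega>\<bar> powr p + \<bar>Y \<omega>\<bar> powr p))"
      using assms(1,2) by (simp add: Lp_def)
  qed (auto simp: le)
  then show ?thesis
    by (simp add: Lp_def)
qed

lemma monetary_mono:
  assumes "monetary P p \<rho>" "X \<in> Lp P p" "Y \<in> Lp P p" "\<And>\<omega>. \<omega> \<in> space P \<Longrightarrow> X \<omega> \<le> Y \<omega>"
  shows "\<rho> X \<le> \<rho> Y"
proof -
  have "AE \<omega> in P. X \<omega> \<le> Y \<omega>"
    using assms(4) by (rule AE_I2)
  with assms(1-3) show ?thesis
    by (auto simp: monetary_def)
qed

text \<open>
  The Fatou property requires convergence. It is applied to \<open>min X (inf\<^bsub>m \<ge> k\<^esub> X\<^sub>m)\<close>,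
  which converges to \<open>X\<close> and lies below \<open>X\<^sub>k\<close>.
\<close>

lemma fatou_property_le_liminf:
  assumes \<rho>: "monetary P p \<rho>" "fatou_property P p \<rho>" "0 \<le> p"
    and meas [measurable]: "\<And>k. Xs k \<in> borel_measurable P" "X \<in> borel_measurable P"
    and Y: "Y \<in> Lp P p"
    and Xs_le: "\<And>k \<omega>. \<omega> \<in> space P \<Longrightarrow> \<bar>Xs k \<omega>\<bar> \<le> Y \<omega>"
    and X_le: "\<And>\<omega>. \<omega> \<in> space P \<Longrightarrow> \<bar>X \<omega>\<bar> \<le> Y \<omega>"
    and lsc: "\<And>\<omega> r. \<omega> \<in> space P \<Longrightarrow> r < X \<omega> \<Longrightarrow> \<forall>\<^sub>F k in sequentially. r < Xs k \<omega>"
  shows "\<rho> X \<le> liminf (\<lambda>k. \<rho> (Xs k))"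
proof -
  define W where "W k \<omega> = min (X \<omega>) (INF m\<in>{k..}. Xs m \<omega>)" for k \<omega>
  \<comment> \<open>Real infima behave as such only on sets bounded below; the dominating
    \<open>Y\<close> ensures this for every tail.\<close>
  have bdd: "bdd_below ((\<lambda>m. Xs m \<omega>) ` I)" if "\<omega> \<in> space P" for \<omega> I
  proof (rule bdd_belowI2)
    show "- Y \<omega> \<le> Xs m \<omega>" for m
      using Xs_le[OF that, of m] by linarith
  qed
  have W_le: "W k \<omega> \<le> Xs k \<omega>" if "\<omega> \<in> space P" for k \<omega>
  proof -
    have "(INF m\<in>{k..}. Xs m \<omega>) \<le> Xs k \<omega>"
      by (rule cINF_lower[OF bdd[OF that]]) simp
    then show ?thesis
      by (simp add: W_def)
  qed
  have W_bound: "\<bar>W k \<omega>\<bar> \<le> Y \<omega>" if "\<omega> \<in> space P" for k \<omega>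
  proof -
    have "- Y \<omega> \<le> (INF m\<in>{k..}. Xs m \<omega>)"
    proof (rule cINF_greatest)
      show "- Y \<omega> \<le> Xs m \<omega>" for m
        using Xs_le[OF that, of m] by linarith
    qed simp
    then show ?thesis
      using X_le[OF that] W_le[OF that, of k] by (auto simp: W_def min_def abs_le_iff)
  qed
  have W_meas: "W k \<in> borel_measurable P" for k
    unfolding W_def[abs_def] by measurable
  have in_Lp: "W k \<in> Lp P p" "Xs k \<in> Lp P p" "X \<in> Lp P p" for k
    using Lp_dominated[OF Y _ \<rho>(3)] W_meas W_bound X_le Xs_le meas by auto
  have W_lim: "(\<lambda>k. W k \<omega>) \<longlonglongrightarrow> X \<omega>" if \<omega>: "\<omega> \<in> space P" for \<omega>
  proof (rule order_tendstoI)
    fix r assume "r < X \<omega>"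
    \<comment> \<open>The infimum over a tail turns strict bounds into weak ones; the intermediate
      \<open>r'\<close> restores strictness.\<close>
    then obtain r' where r': "r < r'" "r' < X \<omega>"
      using dense by blast
    obtain K where K: "\<And>m. K \<le> m \<Longrightarrow> r' < Xs m \<omega>"
      using lsc[OF \<omega> r'(2)] by (auto simp: eventually_sequentially)
    have "r < W k \<omega>" if "K \<le> k" for k
    proof -
      have "r' \<le> (INF m\<in>{k..}. Xs m \<omega>)"
        by (rule cINF_greatest) (use K that in \<open>auto intro: less_imp_le\<close>)
      with r' show ?thesis
        by (simp add: W_def)
    qed
    then show "\<forall>\<^sub>F k in sequentially. r < W k \<omega>"
      by (auto simp: eventually_sequentially)
  next
    \<comment> \<open>The upper half of the convergence is due to the truncation at
      \<open>X\<close>: the sequence itself may stay far above its lower limit.\<close>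
    fix r assume "X \<omega> < r"
    then show "\<forall>\<^sub>F k in sequentially. W k \<omega> < r"
      by (simp add: W_def min_less_iff_disj)
  qed
  have "\<rho> X \<le> liminf (\<lambda>k. \<rho> (W k))"
    using \<rho>(2) in_Lp Y W_bound W_lim unfolding fatou_property_def by (blast intro: AE_I2)
  also have "\<dots> \<le> liminf (\<lambda>k. \<rho> (Xs k))"
    by (intro Liminf_mono always_eventually allI monetary_mono[OF \<rho>(1)] in_Lp W_le)
  finally show ?thesis .
qed

section \<open>The decision model\<close>

locale risk_decision_model =
  fixes \<M> :: "('w, 'e::polish_space, 'a::polish_space, 'z) model"
    and bl bu :: "'e \<Rightarrow> real" and el eu :: real
  assumes model: "decision_model \<M>"
    and values_measurable:
      "\<And>\<pi> n. \<pi> \<in> policies \<M> \<Longrightarrow> n \<le> horizon \<M> \<Longrightarrow>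
         pol_value \<M> \<pi> n \<in> borel_measurable (hist_space \<M> n)"
    and compact_adm:
      "\<And>n x. n < horizon \<M> \<Longrightarrow> x \<in> St \<M> \<Longrightarrow> compact (adm \<M> n x)"
    and usc_adm:
      "\<And>n xs x as. n < horizon \<M> \<Longrightarrow> (\<And>k. xs k \<in> St \<M>) \<Longrightarrow> x \<in> St \<M> \<Longrightarrow>
         xs \<longlonglongrightarrow> x \<Longrightarrow> (\<And>k. as k \<in> adm \<M> n (xs k)) \<Longrightarrow>
         \<exists>a\<in>adm \<M> n x. accumulation_point as a"
    and trans_continuous:
      "\<And>n z. n < horizon \<M> \<Longrightarrow> z \<in> space (Zsp \<M>) \<Longrightarrow>
         continuous_on (Adm \<M> n) (\<lambda>(x, a). trans_fun \<M> n x a z)"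
    and cost_lsc:
      "\<And>n. n < horizon \<M> \<Longrightarrow> lsc_on (Adm \<M> n \<times> St \<M>) (\<lambda>((x, a), y). cost \<M> n x a y)"
    and tcost_lsc: "lsc_on (St \<M>) (tcost \<M>)"
    and eps: "0 \<le> el" "0 \<le> eu"
    and bl: "\<And>x. x \<in> St \<M> \<Longrightarrow> bl x \<le> - el"
    and bu: "\<And>x. x \<in> St \<M> \<Longrightarrow> eu \<le> bu x"
    and bounds:
      "\<And>\<pi> n h. \<pi> \<in> policies \<M> \<Longrightarrow> n \<le> horizon \<M> \<Longrightarrow> h \<in> histories \<M> n \<Longrightarrow>
         ereal (bl (last_state n h)) \<le> pol_value \<M> \<pi> n h \<and>
         pol_value \<M> \<pi> n h \<le> ereal (bu (last_state n h))"
    and local_bounds: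
      "\<And>n x' a'. n < horizon \<M> \<Longrightarrow> (x', a') \<in> Adm \<M> n \<Longrightarrow>
         \<exists>\<epsilon>>0. \<exists>\<Theta>1\<in>borel_measurable (Zsp \<M>). \<exists>\<Theta>2\<in>borel_measurable (Zsp \<M>).
           (\<forall>z\<in>space (Zsp \<M>). 0 \<le> \<Theta>1 z \<and> 0 \<le> \<Theta>2 z) \<and>
           (\<lambda>\<omega>. \<Theta>1 (dist_rv \<M> (Suc n) \<omega>)) \<in> Lp (Pr \<M>) (expo \<M>) \<and>
           (\<lambda>\<omega>. \<Theta>2 (dist_rv \<M> (Suc n) \<omega>)) \<in> Lp (Pr \<M>) (expo \<M>) \<and>
           (\<forall>z\<in>space (Zsp \<M>). \<forall>(x, a)\<in>Adm \<M> n \<inter> cball (x', a') \<epsilon>.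
              \<bar>cost \<M> n x a (trans_fun \<M> n x a z)\<bar> \<le> \<Theta>1 z \<and>
              bu (trans_fun \<M> n x a z) - bl (trans_fun \<M> n x a z) \<le> \<Theta>2 z)"
    and risk:
      "\<And>n. n < horizon \<M> \<Longrightarrow>
         monetary (Pr \<M>) (expo \<M>) (risk \<M> n) \<and> fatou_property (Pr \<M>) (expo \<M>) (risk \<M> n)"
begin

section \<open>Measurability and integrability of the one-stage arguments\<close>

abbreviation "N \<equiv> horizon \<M>"

abbreviation next_state :: "nat \<Rightarrow> 'e \<Rightarrow> 'a \<Rightarrow> 'w \<Rightarrow> 'e" where
  "next_state n x a \<omega> \<equiv> trans_fun \<M> n x a (dist_rv \<M> (Suc n) \<omega>)"

abbreviation S_borel :: "'e measure" where
  "S_borel \<equiv> restrict_space borel (St \<M>)"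

lemma expo_nonneg: "0 \<le> expo \<M>"
  using model by (simp add: decision_model_def)

lemma AdmD:
  assumes "n < N" "(x, a) \<in> Adm \<M> n"
  shows "x \<in> St \<M> \<and> a \<in> Act \<M>"
proof -
  have "Adm \<M> n \<subseteq> St \<M> \<times> Act \<M>"
    using model assms(1) by (simp add: decision_model_def)
  with assms(2) show ?thesis
    by blast
qed

lemma measurable_dist_rv [measurable]: "dist_rv \<M> (Suc n) \<in> Pr \<M> \<rightarrow>\<^sub>M Zsp \<M>"
proof -
  interpret prob_space "Pr \<M>"
    using model by (simp add: decision_model_def)
  have "indep_vars (\<lambda>_. Zsp \<M>) (dist_rv \<M>) {1..}"
    using model by (simp add: decision_model_def)
  then show ?thesis
    by (auto simp: indep_vars_def2)
qed

lemma measurable_next_state: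
  assumes "n < N" "(x, a) \<in> Adm \<M> n"
  shows "next_state n x a \<in> Pr \<M> \<rightarrow>\<^sub>M S_borel"
proof -
  have "(\<lambda>((x, a), z). trans_fun \<M> n x a z) \<in> restrict_space borel (Adm \<M> n) \<Otimes>\<^sub>M Zsp \<M> \<rightarrow>\<^sub>M S_borel"
    using model assms(1) by (simp add: decision_model_def)
  moreover have "(\<lambda>\<omega>. ((x, a), dist_rv \<M> (Suc n) \<omega>)) \<in>
      Pr \<M> \<rightarrow>\<^sub>M restrict_space borel (Adm \<M> n) \<Otimes>\<^sub>M Zsp \<M>"
    by (intro measurable_Pair measurable_const measurable_dist_rv)
      (use assms(2) in \<open>simp add: space_restrict_space\<close>)
  ultimately have "(\<lambda>\<omega>. (\<lambda>((x, a), z). trans_fun \<M> n x a z) ((x, a), dist_rv \<M> (Suc n) \<omega>)) \<in> Pr \<M> \<rightarrow>\<^sub>M S_borel"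
    by (rule measurable_compose[rotated])
  then show ?thesis
    by simp
qed

lemma next_state_in_St:
  assumes "n < N" "(x, a) \<in> Adm \<M> n" "\<omega> \<in> space (Pr \<M>)"
  shows "next_state n x a \<omega> \<in> St \<M>"
  using measurable_space[OF measurable_next_state[OF assms(1,2)] assms(3)]
  by (simp add: space_restrict_space)

text \<open>The model demands no measurability of the costs; it comes from lower
  semicontinuity.\<close>

lemma measurable_cost:
  assumes "n < N" "(x, a) \<in> Adm \<M> n"
  shows "(\<lambda>\<omega>. cost \<M> n x a (next_state n x a \<omega>)) \<in> borel_measurable (Pr \<M>)"
proof -
  have "next_state n x a \<in> borel_measurable (Pr \<M>)"
    using measurable_next_state[OF assms] by (simp add: measurable_restrict_space2_iff)
  then have "(\<lambda>\<omega>. ((x, a), next_state n x a \<omega>)) \<in>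
      Pr \<M> \<rightarrow>\<^sub>M restrict_space borel (Adm \<M> n \<times> St \<M>)"
    by (intro measurable_restrict_space2 borel_measurable_Pair)
      (use assms next_state_in_St in auto)
  from measurable_compose[OF this borel_measurable_lsc_on[OF cost_lsc[OF assms(1)]]]
  show ?thesis
    by simp
qed

text \<open>The bounds have opposite signs, as \<open>bl y\<close> is at most 0 and
  \<open>bu y\<close> at least 0; hence both \<open>bu y\<close> and \<open>- bl y\<close> are at
  most their sum.\<close>

lemma abs_le_bounding:
  assumes "y \<in> St \<M>" "bl y \<le> w" "w \<le> bu y"
  shows "\<bar>w\<bar> \<le> bu y - bl y"
  using assms bl[of y] bu[of y] eps by linarith

text \<open>The local bounds are used at the centre of their own ball. \<open>W\<close> is kept
  abstract because it stands for a function of the next state as well as for a policy value, which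
  depends on the whole extended history.\<close>

lemma cost_plus_in_Lp:
  assumes n: "n < N" and xa: "(x, a) \<in> Adm \<M> n" and W: "W \<in> borel_measurable (Pr \<M>)"
    and W_bounds: "\<And>\<omega>. \<omega> \<in> space (Pr \<M>) \<Longrightarrow>
      bl (next_state n x a \<omega>) \<le> W \<omega> \<and> W \<omega> \<le> bu (next_state n x a \<omega>)"
  shows "(\<lambda>\<omega>. cost \<M> n x a (next_state n x a \<omega>) + W \<omega>) \<in> Lp (Pr \<M>) (expo \<M>)"
proof -
  obtain \<epsilon> \<Theta>1 \<Theta>2 where *: "\<epsilon> > 0"
      "(\<lambda>\<omega>. \<Theta>1 (dist_rv \<M> (Suc n) \<omega>)) \<in> Lp (Pr \<M>) (expo \<M>)"
      "(\<lambda>\<omega>. \<Theta>2 (dist_rv \<M> (Suc n) \<omega>)) \<in> Lp (Pr \<M>) (expo \<M>)"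
      "\<forall>z\<in>space (Zsp \<M>). \<forall>(x, a)\<in>Adm \<M> n \<inter> cball (x, a) \<epsilon>.
         \<bar>cost \<M> n x a (trans_fun \<M> n x a z)\<bar> \<le> \<Theta>1 z \<and>
         bu (trans_fun \<M> n x a z) - bl (trans_fun \<M> n x a z) \<le> \<Theta>2 z"
    using local_bounds[OF n xa] by blast
  show ?thesis
  proof (rule Lp_dominated[OF Lp_add[OF *(2,3) expo_nonneg] _ expo_nonneg])
    show "(\<lambda>\<omega>. cost \<M> n x a (next_state n x a \<omega>) + W \<omega>) \<in> borel_measurable (Pr \<M>)"
      using measurable_cost[OF n xa] W by measurable
    fix \<omega> assume \<omega>: "\<omega> \<in> space (Pr \<M>)"
    let ?z = "dist_rv \<M> (Suc n) \<omega>"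
    have "?z \<in> space (Zsp \<M>)" "(x, a) \<in> Adm \<M> n \<inter> cball (x, a) \<epsilon>"
      using measurable_space[OF measurable_dist_rv \<omega>] xa *(1) by auto
    with *(4) have "\<bar>cost \<M> n x a (next_state n x a \<omega>)\<bar> \<le> \<Theta>1 ?z"
        "bu (next_state n x a \<omega>) - bl (next_state n x a \<omega>) \<le> \<Theta>2 ?z"
      by blast+
    moreover have "\<bar>W \<omega>\<bar> \<le> bu (next_state n x a \<omega>) - bl (next_state n x a \<omega>)"
      using abs_le_bounding[OF next_state_in_St[OF n xa \<omega>]] W_bounds[OF \<omega>] by blast
    ultimately show "\<bar>cost \<M> n x a (next_state n x a \<omega>) + W \<omega>\<bar> \<le> \<Theta>1 ?z + \<Theta>2 ?z"
      by linarith
  qed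
qed

section \<open>Lower semicontinuity of the one-stage operators\<close>

definition bounded_lsc :: "('e \<Rightarrow> real) \<Rightarrow> bool" where
  "bounded_lsc v \<longleftrightarrow> lsc_on (St \<M>) v \<and> (\<forall>x\<in>St \<M>. bl x \<le> v x \<and> v x \<le> bu x)"

lemma measurable_next_value:
  assumes "bounded_lsc v" "n < N" "(x, a) \<in> Adm \<M> n"
  shows "(\<lambda>\<omega>. v (next_state n x a \<omega>)) \<in> borel_measurable (Pr \<M>)"
  using measurable_compose[OF measurable_next_state[OF assms(2,3)] borel_measurable_lsc_on]
    assms(1) by (auto simp: bounded_lsc_def)

text \<open>For a fixed outcome the next states converge by continuity of the transition, so cost
  plus \<open>v\<close> is lower semicontinuous along the sequence;
  \<open>fatou_property_le_liminf\<close> does the rest. Domination is asked for only at the points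
  of the sequence and its limit, because the available bounds are local.\<close>

lemma L_op_le_liminf:
  assumes v: "bounded_lsc v" and n: "n < N"
    and xs: "\<And>k. (xs k, as k) \<in> Adm \<M> n" "(x, a) \<in> Adm \<M> n" "xs \<longlonglongrightarrow> x" "as \<longlonglongrightarrow> a"
    and Y: "(\<lambda>\<omega>. \<Theta> (dist_rv \<M> (Suc n) \<omega>)) \<in> Lp (Pr \<M>) (expo \<M>)"
    and bound: "\<And>z x' a'. z \<in> space (Zsp \<M>) \<Longrightarrow> (x', a') \<in> insert (x, a) (range (\<lambda>k. (xs k, as k))) \<Longrightarrow>
      \<bar>cost \<M> n x' a' (trans_fun \<M> n x' a' z) + v (trans_fun \<M> n x' a' z)\<bar> \<le> \<Theta> z"
  shows "L_op \<M> n v x a \<le> liminf (\<lambda>k. L_op \<M> n v (xs k) (as k))"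
  unfolding L_op_def Let_def
proof (rule fatou_property_le_liminf[OF _ _ expo_nonneg _ _ Y])
  show "monetary (Pr \<M>) (expo \<M>) (risk \<M> n)" "fatou_property (Pr \<M>) (expo \<M>) (risk \<M> n)"
    using risk[OF n] by auto
  show "(\<lambda>\<omega>. cost \<M> n (xs k) (as k) (next_state n (xs k) (as k) \<omega>) + v (next_state n (xs k) (as k) \<omega>))
      \<in> borel_measurable (Pr \<M>)" for k
    by (intro borel_measurable_add measurable_cost measurable_next_value v n xs)
  show "(\<lambda>\<omega>. cost \<M> n x a (next_state n x a \<omega>) + v (next_state n x a \<omega>)) \<in> borel_measurable (Pr \<M>)"
    by (intro borel_measurable_add measurable_cost measurable_next_value v n xs)
next
  fix \<omega> assume \<omega>: "\<omega> \<in> space (Pr \<M>)"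
  then have z: "dist_rv \<M> (Suc n) \<omega> \<in> space (Zsp \<M>)"
    by (rule measurable_space[OF measurable_dist_rv])
  show "\<bar>cost \<M> n (xs k) (as k) (next_state n (xs k) (as k) \<omega>) + v (next_state n (xs k) (as k) \<omega>)\<bar>
      \<le> \<Theta> (dist_rv \<M> (Suc n) \<omega>)" for k
    by (rule bound[OF z]) auto
  show "\<bar>cost \<M> n x a (next_state n x a \<omega>) + v (next_state n x a \<omega>)\<bar> \<le> \<Theta> (dist_rv \<M> (Suc n) \<omega>)"
    by (rule bound[OF z]) auto
  fix r assume r: "r < cost \<M> n x a (next_state n x a \<omega>) + v (next_state n x a \<omega>)"
  let ?y = "next_state n x a \<omega>" and ?ys = "\<lambda>k. next_state n (xs k) (as k) \<omega>"
  have St: "?y \<in> St \<M>" "?ys k \<in> St \<M>" for k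
    by (intro next_state_in_St n xs \<omega>)+
  have lim_xa: "(\<lambda>k. (xs k, as k)) \<longlonglongrightarrow> (x, a)"
    by (intro tendsto_Pair xs)
  have lim: "?ys \<longlonglongrightarrow> ?y"
    using continuous_on_tendsto_compose[OF trans_continuous[OF n z] lim_xa xs(2)] xs(1) by simp
  \<comment> \<open>Half of the gap above \<open>r\<close> is granted to each of the two lower
    semicontinuous summands.\<close>
  define \<delta> where "\<delta> = (cost \<M> n x a ?y + v ?y - r) / 2"
  have \<delta>: "\<delta> > 0"
    using r by (simp add: \<delta>_def)
  have "\<forall>\<^sub>F k in sequentially. cost \<M> n x a ?y - \<delta> <
      (\<lambda>((x, a), y). cost \<M> n x a y) ((xs k, as k), ?ys k)"
    by (rule lsc_on_eventually_sequentially[OF cost_lsc[OF n], of "((x, a), ?y)"])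
      (use St xs \<delta> lim lim_xa in \<open>auto intro: tendsto_Pair\<close>)
  moreover have "\<forall>\<^sub>F k in sequentially. v ?y - \<delta> < v (?ys k)"
    by (rule lsc_on_eventually_sequentially[of "St \<M>"])
      (use v St \<delta> lim in \<open>auto simp: bounded_lsc_def\<close>)
  ultimately show "\<forall>\<^sub>F k in sequentially. r < cost \<M> n (xs k) (as k) (?ys k) + v (?ys k)"
  proof eventually_elim
    case (elim k)
    then have "cost \<M> n x a ?y - \<delta> + (v ?y - \<delta>) < cost \<M> n (xs k) (as k) (?ys k) + v (?ys k)"
      by simp
    then show ?case
      by (simp add: \<delta>_def field_simps)
  qed
qed

text \<open>The integrable bounds hold near \<open>(x, a)\<close> only. Restricting to the open ball
  of radius \<epsilon> leaves the filter at \<open>(x, a)\<close> unchanged, and in a metric space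
  it suffices to test sequences, which \<open>L_op_le_liminf\<close> handles.\<close>

lemma lsc_on_L_op:
  assumes v: "bounded_lsc v" and n: "n < N"
  shows "lsc_on (Adm \<M> n) (\<lambda>(x, a). L_op \<M> n v x a)"
  unfolding lsc_on_def
proof (intro ballI allI impI)
  fix xa r assume xa: "xa \<in> Adm \<M> n" and r: "r < (\<lambda>(x, a). L_op \<M> n v x a) xa"
  obtain x a where [simp]: "xa = (x, a)"
    by (cases xa)
  obtain \<epsilon> \<Theta>1 \<Theta>2 where *: "\<epsilon> > 0"
      "(\<lambda>\<omega>. \<Theta>1 (dist_rv \<M> (Suc n) \<omega>)) \<in> Lp (Pr \<M>) (expo \<M>)"
      "(\<lambda>\<omega>. \<Theta>2 (dist_rv \<M> (Suc n) \<omega>)) \<in> Lp (Pr \<M>) (expo \<M>)"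
      "\<forall>z\<in>space (Zsp \<M>). \<forall>(x, a)\<in>Adm \<M> n \<inter> cball (x, a) \<epsilon>.
         \<bar>cost \<M> n x a (trans_fun \<M> n x a z)\<bar> \<le> \<Theta>1 z \<and>
         bu (trans_fun \<M> n x a z) - bl (trans_fun \<M> n x a z) \<le> \<Theta>2 z"
    using local_bounds[OF n, of x a] xa by auto
  have trans_St: "trans_fun \<M> n x' a' z \<in> St \<M>" if "(x', a') \<in> Adm \<M> n" "z \<in> space (Zsp \<M>)" for x' a' z
  proof -
    have "(\<lambda>((x, a), z). trans_fun \<M> n x a z) \<in> restrict_space borel (Adm \<M> n) \<Otimes>\<^sub>M Zsp \<M> \<rightarrow>\<^sub>M S_borel"
      using model n by (simp add: decision_model_def)
    from measurable_space[OF this, of "((x', a'), z)"] that show ?thesis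
      by (simp add: space_pair_measure space_restrict_space)
  qed
  have bound: "\<bar>cost \<M> n x' a' (trans_fun \<M> n x' a' z) + v (trans_fun \<M> n x' a' z)\<bar> \<le> \<Theta>1 z + \<Theta>2 z"
    if "z \<in> space (Zsp \<M>)" "(x', a') \<in> Adm \<M> n \<inter> ball (x, a) \<epsilon>" for x' a' z
  proof -
    have "(x', a') \<in> Adm \<M> n \<inter> cball (x, a) \<epsilon>"
      using that(2) by auto
    with *(4) that(1) have "\<bar>cost \<M> n x' a' (trans_fun \<M> n x' a' z)\<bar> \<le> \<Theta>1 z"
        "bu (trans_fun \<M> n x' a' z) - bl (trans_fun \<M> n x' a' z) \<le> \<Theta>2 z"
      by blast+
    moreover have "\<bar>v (trans_fun \<M> n x' a' z)\<bar> \<le> bu (trans_fun \<M> n x' a' z) - bl (trans_fun \<M> n x' a' z)"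
      using v trans_St[of x' a' z] that by (intro abs_le_bounding) (auto simp: bounded_lsc_def)
    ultimately show ?thesis
      by linarith
  qed
  have "\<forall>\<^sub>F y in at (x, a) within Adm \<M> n \<inter> ball (x, a) \<epsilon>. r < (\<lambda>(x, a). L_op \<M> n v x a) y"
  proof (rule sequentially_imp_eventually_within, intro allI impI)
    fix ys assume ys: "(\<forall>k. ys k \<in> Adm \<M> n \<inter> ball (x, a) \<epsilon> \<and> ys k \<noteq> (x, a)) \<and> ys \<longlonglongrightarrow> (x, a)"
    define xs as where "xs k = fst (ys k)" and "as k = snd (ys k)" for k
    have ys_eq: "ys k = (xs k, as k)" for k
      by (simp add: xs_def as_def)
    have "xs \<longlonglongrightarrow> x" "as \<longlonglongrightarrow> a"
      using ys tendsto_fst[of ys "(x, a)"] tendsto_snd[of ys "(x, a)"]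
      by (auto simp: xs_def[abs_def] as_def[abs_def])
    then have "L_op \<M> n v x a \<le> liminf (\<lambda>k. L_op \<M> n v (xs k) (as k))"
    proof (rule L_op_le_liminf[OF v n, rotated 2])
      show "(xs k, as k) \<in> Adm \<M> n" for k
        using ys unfolding ys_eq by blast
      show "(x, a) \<in> Adm \<M> n"
        using xa by simp
      show "(\<lambda>\<omega>. \<Theta>1 (dist_rv \<M> (Suc n) \<omega>) + \<Theta>2 (dist_rv \<M> (Suc n) \<omega>)) \<in> Lp (Pr \<M>) (expo \<M>)"
        by (rule Lp_add[OF *(2,3) expo_nonneg])
      fix z x' a' assume "z \<in> space (Zsp \<M>)" "(x', a') \<in> insert (x, a) (range (\<lambda>k. (xs k, as k)))"
      moreover from this(2) have "(x', a') \<in> Adm \<M> n \<inter> ball (x, a) \<epsilon>"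
        using ys *(1) xa unfolding ys_eq by auto
      ultimately show "\<bar>cost \<M> n x' a' (trans_fun \<M> n x' a' z) + v (trans_fun \<M> n x' a' z)\<bar> \<le> \<Theta>1 z + \<Theta>2 z"
        by (intro bound)
    qed
    with r have "r < liminf (\<lambda>k. L_op \<M> n v (xs k) (as k))"
      by simp
    then show "\<forall>\<^sub>F k in sequentially. r < (\<lambda>(x, a). L_op \<M> n v x a) (ys k)"
      unfolding ys_eq by (simp add: less_LiminfD)
  qed
  moreover have "at (x, a) within Adm \<M> n \<inter> ball (x, a) \<epsilon> = at xa within Adm \<M> n"
    using at_within_nhd[of xa "ball (x, a) \<epsilon>" "Adm \<M> n \<inter> ball (x, a) \<epsilon>" "Adm \<M> n"] *(1) by auto
  ultimately show "\<forall>\<^sub>F y in at xa within Adm \<M> n. r < (\<lambda>(x, a). L_op \<M> n v x a) y"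
    by simp
qed

lemma usc_graph_Adm: "n < N \<Longrightarrow> usc_graph (St \<M>) (Adm \<M> n)"
proof (unfold_locales, goal_cases)
  case (1 xs x as)
  then show ?case
    using usc_adm[of n xs x as] by (auto simp: adm_def)
qed

lemma lsc_on_T_op:
  assumes "bounded_lsc v" "n < N"
  shows "lsc_on (St \<M>) (T_op \<M> n v)"
  using usc_graph.lsc_on_INF[OF usc_graph_Adm[OF assms(2)] lsc_on_L_op[OF assms] closed_UNIV]
  by (simp add: T_op_def[abs_def] adm_def)

section \<open>Markov decision rules and Markov policies\<close>

lemma markov_rules_nonempty:
  assumes "n < N"
  shows "markov_rules \<M> n \<noteq> {}"
proof -
  have "\<exists>f \<in> S_borel \<rightarrow>\<^sub>M restrict_space borel (Act \<M>). \<forall>x\<in>St \<M>. (x, f x) \<in> Adm \<M> n"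
    using model assms by (simp add: decision_model_def)
  then obtain f where "f \<in> S_borel \<rightarrow>\<^sub>M restrict_space borel (Act \<M>)" "\<forall>x\<in>St \<M>. (x, f x) \<in> Adm \<M> n"
    by blast
  then have "f \<in> markov_rules \<M> n"
    by (simp add: markov_rules_def adm_def)
  then show ?thesis
    by blast
qed

lemma minimizer_exists:
  assumes v: "bounded_lsc v" and n: "n < N"
  shows "\<exists>d\<in>markov_rules \<M> n. \<forall>x\<in>St \<M>. T_op \<M> n v x = T_rule \<M> n d v x"
proof -
  have "compact {a. (x, a) \<in> Adm \<M> n}" "{a. (x, a) \<in> Adm \<M> n} \<noteq> {}" if "x \<in> St \<M>" for x
    using compact_adm[OF n that] markov_rules_nonempty[OF n] that
    by (auto simp: adm_def markov_rules_def)
  then obtain s where s: "s \<in> borel_measurable S_borel" "\<And>x. x \<in> St \<M> \<Longrightarrow> (x, s x) \<in> Adm \<M> n"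
      "\<And>x. x \<in> St \<M> \<Longrightarrow> (\<lambda>(x, a). L_op \<M> n v x a) (x, s x) =
         (INF a\<in>{a. (x, a) \<in> Adm \<M> n}. (\<lambda>(x, a). L_op \<M> n v x a) (x, a))"
    using usc_graph.measurable_minimizer[OF usc_graph_Adm[OF n] lsc_on_L_op[OF v n]] by blast
  have "s \<in> markov_rules \<M> n"
    using s(1) s(2)[THEN AdmD[OF n]] s(2)
    by (simp add: markov_rules_def adm_def space_restrict_space measurable_restrict_space2_iff)
  with s(3) show ?thesis
    by (intro bexI[of _ s]) (simp_all add: T_op_def T_rule_def adm_def)
qed

lemma markov_policy_in_markov_policies:
  assumes d: "\<And>n. n < N \<Longrightarrow> d n \<in> markov_rules \<M> n"
  shows "markov_policy d \<in> markov_policies \<M>"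
proof -
  have "markov_policy d n \<in> hist_space \<M> n \<rightarrow>\<^sub>M restrict_space borel (Act \<M>)" if "n < N" for n
  proof -
    have "(\<lambda>h. fst h n) \<in> (\<Pi>\<^sub>M k\<in>{..n}. S_borel) \<Otimes>\<^sub>M (\<Pi>\<^sub>M k\<in>{..<n}. restrict_space borel (Act \<M>)) \<rightarrow>\<^sub>M S_borel"
      by (rule measurable_compose[OF measurable_fst measurable_component_singleton]) simp
    then have "(\<lambda>h. fst h n) \<in> hist_space \<M> n \<rightarrow>\<^sub>M S_borel"
      unfolding hist_space_def by (rule measurable_restrict_space1)
    moreover have "d n \<in> S_borel \<rightarrow>\<^sub>M restrict_space borel (Act \<M>)"
      using d[OF that] by (simp add: markov_rules_def)
    ultimately show ?thesis
      unfolding markov_policy_def[abs_def] last_state_def by (rule measurable_compose)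
  qed
  moreover have "markov_policy d n h \<in> adm \<M> n (last_state n h)" if "n < N" "h \<in> histories \<M> n" for n h
  proof -
    have "last_state n h \<in> St \<M>"
      using that(2) by (auto simp: histories_def last_state_def)
    then show ?thesis
      using d[OF that(1)] by (simp add: markov_policy_def markov_rules_def)
  qed
  ultimately show ?thesis
    by (auto simp: markov_policies_def policies_def markov_policy_def)
qed

lemma markov_policies_subset: "markov_policies \<M> \<subseteq> policies \<M>"
  by (auto simp: markov_policies_def)

lemma markov_policies_nonempty: "markov_policies \<M> \<noteq> {}"
proof -
  have "\<forall>n. \<exists>f. n < N \<longrightarrow> f \<in> markov_rules \<M> n"
    using markov_rules_nonempty by blast
  then obtain d where "\<And>n. n < N \<Longrightarrow> d n \<in> markov_rules \<M> n"
    by metis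
  from markov_policy_in_markov_policies[OF this] show ?thesis
    by blast
qed

subsection \<open>Histories\<close>

lemma last_state_in_St: "h \<in> histories \<M> n \<Longrightarrow> last_state n h \<in> St \<M>"
  by (auto simp: histories_def last_state_def)

lemma init_hist_in_histories: "x \<in> St \<M> \<Longrightarrow> init_hist x \<in> histories \<M> 0"
  by (auto simp: init_hist_def histories_def)

lemma last_state_init_hist [simp]: "last_state 0 (init_hist x) = x"
  by (simp add: last_state_def init_hist_def)

lemma last_state_extend_hist [simp]: "last_state (Suc n) (extend_hist n h a y) = y"
  by (simp add: last_state_def extend_hist_def)

lemma extend_hist_in_histories:
  assumes "n < N" "h \<in> histories \<M> n" "a \<in> adm \<M> n (last_state n h)" "y \<in> St \<M>"
  shows "extend_hist n h a y \<in> histories \<M> (Suc n)"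
proof -
  have "a \<in> Act \<M>"
    using assms(3) AdmD[OF assms(1)] by (auto simp: adm_def)
  then show ?thesis
    using assms
    by (auto simp: histories_def extend_hist_def last_state_def PiE_iff extensional_def less_Suc_eq)
qed

text \<open>Histories constrain the actions but do not tie successive states to the transition
  function, so the state \<open>x\<close> can simply be repeated. This makes the choice in
  \<open>markov_value\<close> meaningful.\<close>

lemma history_exists:
  assumes "x \<in> St \<M>" "n \<le> N"
  shows "\<exists>h\<in>histories \<M> n. last_state n h = x"
  using assms(2)
proof (induction n)
  case 0
  then show ?case
    using init_hist_in_histories[OF assms(1)] by (intro bexI[of _ "init_hist x"]) auto
next
  case (Suc n)
  then obtain h where h: "h \<in> histories \<M> n" "last_state n h = x"
    by auto
  obtain f where "f \<in> markov_rules \<M> n"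
    using markov_rules_nonempty[of n] Suc.prems by auto
  then have "f x \<in> adm \<M> n (last_state n h)"
    using h assms(1) by (simp add: markov_rules_def)
  then have "extend_hist n h (f x) x \<in> histories \<M> (Suc n)"
    using extend_hist_in_histories[OF _ h(1)] assms(1) Suc.prems by simp
  then show ?case
    by (intro bexI[of _ "extend_hist n h (f x) x"]) auto
qed

text \<open>Composed with the assumed measurability of policy values on \<open>hist_space\<close>,
  this turns next-stage values into random variables.\<close>

lemma measurable_extend_hist:
  assumes "n < N" "h \<in> histories \<M> n" "a \<in> adm \<M> n (last_state n h)" "g \<in> Q \<rightarrow>\<^sub>M S_borel"
  shows "(\<lambda>\<omega>. extend_hist n h a (g \<omega>)) \<in> Q \<rightarrow>\<^sub>M hist_space \<M> (Suc n)"
  unfolding hist_space_def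
proof (rule measurable_restrict_space2)
  have g: "g \<omega> \<in> St \<M>" if "\<omega> \<in> space Q" for \<omega>
    using measurable_space[OF assms(4) that] by (simp add: space_restrict_space)
  have ext: "extend_hist n h a (g \<omega>) \<in> histories \<M> (Suc n)" if "\<omega> \<in> space Q" for \<omega>
    by (rule extend_hist_in_histories[OF assms(1-3) g[OF that]])
  then show "(\<lambda>\<omega>. extend_hist n h a (g \<omega>)) \<in> space Q \<rightarrow> histories \<M> (Suc n)"
    by blast
  have "(\<lambda>\<omega>. (fst h)(Suc n := g \<omega>)) \<in> Q \<rightarrow>\<^sub>M (\<Pi>\<^sub>M k\<in>{..Suc n}. S_borel)"
  proof (rule measurable_PiM_single')
    show "(\<lambda>\<omega>. ((fst h)(Suc n := g \<omega>)) i) \<in> Q \<rightarrow>\<^sub>M S_borel" if "i \<in> {..Suc n}" for i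
      using assms(2,4) that
      by (cases "i = Suc n") (auto simp: histories_def space_restrict_space PiE_iff)
    show "(\<lambda>\<omega>. (fst h)(Suc n := g \<omega>)) \<in> space Q \<rightarrow> (\<Pi>\<^sub>E i\<in>{..Suc n}. space S_borel)"
      using ext by (auto simp: histories_def extend_hist_def space_restrict_space)
  qed
  moreover have "(\<lambda>\<omega>. (snd h)(n := a)) \<in> Q \<rightarrow>\<^sub>M (\<Pi>\<^sub>M k\<in>{..<Suc n}. restrict_space borel (Act \<M>))"
  \<comment> \<open>The action part is constant, but that it belongs to the product space is read
    off from \<open>ext\<close> at some point of \<open>Q\<close>.\<close>
  proof (cases "space Q = {}")
    case False
    then obtain \<omega> where "\<omega> \<in> space Q"
      by blast
    from ext[OF this] show ?thesis
      by (intro measurable_const) (auto simp: histories_def extend_hist_def space_PiM space_restrict_space)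
  qed (simp add: measurable_def)
  ultimately show "(\<lambda>\<omega>. extend_hist n h a (g \<omega>)) \<in> Q \<rightarrow>\<^sub>M
      (\<Pi>\<^sub>M k\<in>{..Suc n}. S_borel) \<Otimes>\<^sub>M (\<Pi>\<^sub>M k\<in>{..<Suc n}. restrict_space borel (Act \<M>))"
    unfolding extend_hist_def by (rule measurable_Pair)
qed

subsection \<open>Backward induction\<close>

lemma pol_value_horizon: "pol_value \<M> \<pi> N h = ereal (tcost \<M> (last_state N h))"
  by (subst pol_value.simps) simp

definition next_pol_value :: "(nat \<Rightarrow> ('e, 'a) hist \<Rightarrow> 'a) \<Rightarrow> nat \<Rightarrow> ('e, 'a) hist \<Rightarrow> 'w \<Rightarrow> real" where
  "next_pol_value \<pi> n h \<omega> = real_of_ereal (pol_value \<M> \<pi> (Suc n)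
     (extend_hist n h (\<pi> n h) (next_state n (last_state n h) (\<pi> n h) \<omega>)))"

lemma pol_value_step:
  assumes "n < N"
  shows "pol_value \<M> \<pi> n h = risk \<M> n (\<lambda>\<omega>.
    cost \<M> n (last_state n h) (\<pi> n h) (next_state n (last_state n h) (\<pi> n h) \<omega>) + next_pol_value \<pi> n h \<omega>)"
  using assms by (subst pol_value.simps) (simp add: Let_def next_pol_value_def)

lemma policy_Adm:
  assumes "\<pi> \<in> policies \<M>" "n < N" "h \<in> histories \<M> n"
  shows "(last_state n h, \<pi> n h) \<in> Adm \<M> n"
  using assms by (auto simp: policies_def adm_def)

section \<open>Comparison of policy values with the one-stage operators\<close>

context
  fixes \<pi> n h
  assumes \<pi>: "\<pi> \<in> policies \<M>" and n: "n < N" and h: "h \<in> histories \<M> n"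
begin

private abbreviation (input) "x \<equiv> last_state n h"
private abbreviation (input) "a \<equiv> \<pi> n h"

lemma next_hist_in_histories:
  assumes "\<omega> \<in> space (Pr \<M>)"
  shows "extend_hist n h a (next_state n x a \<omega>) \<in> histories \<M> (Suc n)"
  using extend_hist_in_histories[OF n h] next_state_in_St[OF n _ assms] policy_Adm[OF \<pi> n h]
  by (simp add: adm_def)

text \<open>The bounding functions are real valued, so next-stage values are finite and the cast to
  the reals loses nothing.\<close>

lemma ereal_next_pol_value:
  assumes "\<omega> \<in> space (Pr \<M>)"
  shows "ereal (next_pol_value \<pi> n h \<omega>) = pol_value \<M> \<pi> (Suc n) (extend_hist n h a (next_state n x a \<omega>))"
  using bounds[OF \<pi> _ next_hist_in_histories[OF assms]] n
  unfolding next_pol_value_def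
  by (cases "pol_value \<M> \<pi> (Suc n) (extend_hist n h a (next_state n x a \<omega>))") auto

lemma next_pol_value_bounds:
  assumes "\<omega> \<in> space (Pr \<M>)"
  shows "bl (next_state n x a \<omega>) \<le> next_pol_value \<pi> n h \<omega> \<and> next_pol_value \<pi> n h \<omega> \<le> bu (next_state n x a \<omega>)"
  using bounds[OF \<pi> _ next_hist_in_histories[OF assms]] n
  unfolding ereal_next_pol_value[OF assms, symmetric] by simp

lemma measurable_next_pol_value: "next_pol_value \<pi> n h \<in> borel_measurable (Pr \<M>)"
proof -
  have "(\<lambda>\<omega>. extend_hist n h a (next_state n x a \<omega>)) \<in> Pr \<M> \<rightarrow>\<^sub>M hist_space \<M> (Suc n)"
    using policy_Adm[OF \<pi> n h]
    by (intro measurable_extend_hist[OF n h] measurable_next_state[OF n]) (simp_all add: adm_def)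
  then have "(\<lambda>\<omega>. pol_value \<M> \<pi> (Suc n) (extend_hist n h a (next_state n x a \<omega>))) \<in> borel_measurable (Pr \<M>)"
    by (rule measurable_compose) (rule values_measurable[OF \<pi>], use n in simp)
  then show ?thesis
    unfolding next_pol_value_def[abs_def] by (rule borel_measurable_real_of_ereal)
qed

lemma next_arg_in_Lp:
  "(\<lambda>\<omega>. cost \<M> n x a (next_state n x a \<omega>) + next_pol_value \<pi> n h \<omega>) \<in> Lp (Pr \<M>) (expo \<M>)"
  "bounded_lsc v \<Longrightarrow>
    (\<lambda>\<omega>. cost \<M> n x a (next_state n x a \<omega>) + v (next_state n x a \<omega>)) \<in> Lp (Pr \<M>) (expo \<M>)"
proof -
  note xa = policy_Adm[OF \<pi> n h]
  show "(\<lambda>\<omega>. cost \<M> n x a (next_state n x a \<omega>) + next_pol_value \<pi> n h \<omega>) \<in> Lp (Pr \<M>) (expo \<M>)"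
    by (rule cost_plus_in_Lp[OF n xa measurable_next_pol_value next_pol_value_bounds])
  assume v: "bounded_lsc v"
  then show "(\<lambda>\<omega>. cost \<M> n x a (next_state n x a \<omega>) + v (next_state n x a \<omega>)) \<in> Lp (Pr \<M>) (expo \<M>)"
    using next_state_in_St[OF n xa]
    by (intro cost_plus_in_Lp[OF n xa measurable_next_value[OF v n xa]]) (auto simp: bounded_lsc_def)
qed

lemma L_op_le_pol_value:
  assumes v: "bounded_lsc v"
    and le: "\<And>h. h \<in> histories \<M> (Suc n) \<Longrightarrow> ereal (v (last_state (Suc n) h)) \<le> pol_value \<M> \<pi> (Suc n) h"
  shows "L_op \<M> n v x a \<le> pol_value \<M> \<pi> n h"
  unfolding pol_value_step[OF n] L_op_def Let_def
proof (rule monetary_mono[OF _ next_arg_in_Lp(2)[OF v] next_arg_in_Lp(1)])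
  show "monetary (Pr \<M>) (expo \<M>) (risk \<M> n)"
    using risk[OF n] by simp
  show "cost \<M> n x a (next_state n x a \<omega>) + v (next_state n x a \<omega>)
      \<le> cost \<M> n x a (next_state n x a \<omega>) + next_pol_value \<pi> n h \<omega>" if "\<omega> \<in> space (Pr \<M>)" for \<omega>
    using le[OF next_hist_in_histories[OF that]]
    unfolding ereal_next_pol_value[OF that, symmetric] by simp
qed

text \<open>
  The arguments of \<open>risk\<close> agree only on \<open>space (Pr \<M>)\<close>; hence monotonicity
  instead of congruence.
\<close>

lemma pol_value_eq_L_op:
  assumes v: "bounded_lsc v"
    and eq: "\<And>h. h \<in> histories \<M> (Suc n) \<Longrightarrow> pol_value \<M> \<pi> (Suc n) h = ereal (v (last_state (Suc n) h))"
  shows "pol_value \<M> \<pi> n h = L_op \<M> n v x a"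
proof (rule antisym)
  show "L_op \<M> n v x a \<le> pol_value \<M> \<pi> n h"
    by (rule L_op_le_pol_value[OF v]) (simp add: eq)
  show "pol_value \<M> \<pi> n h \<le> L_op \<M> n v x a"
    unfolding pol_value_step[OF n] L_op_def Let_def
  proof (rule monetary_mono[OF _ next_arg_in_Lp(1) next_arg_in_Lp(2)[OF v]])
    show "monetary (Pr \<M>) (expo \<M>) (risk \<M> n)"
      using risk[OF n] by simp
    show "cost \<M> n x a (next_state n x a \<omega>) + next_pol_value \<pi> n h \<omega>
        \<le> cost \<M> n x a (next_state n x a \<omega>) + v (next_state n x a \<omega>)" if "\<omega> \<in> space (Pr \<M>)" for \<omega>
      using eq[OF next_hist_in_histories[OF that]]
      unfolding ereal_next_pol_value[OF that, symmetric] by simp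
  qed
qed

text \<open>The lower half of the Bellman equation. Only the minorant \<open>v\<close> has to be a
  function of the last state; the policy may use the whole history.\<close>

lemma T_op_le_pol_value:
  assumes "bounded_lsc v"
    and "\<And>h. h \<in> histories \<M> (Suc n) \<Longrightarrow> ereal (v (last_state (Suc n) h)) \<le> pol_value \<M> \<pi> (Suc n) h"
  shows "T_op \<M> n v x \<le> pol_value \<M> \<pi> n h"
proof -
  have "T_op \<M> n v x \<le> L_op \<M> n v x a"
    unfolding T_op_def by (rule INF_lower) (use policy_Adm[OF \<pi> n h] in \<open>simp add: adm_def\<close>)
  also note L_op_le_pol_value[OF assms]
  finally show ?thesis .
qed

end

text \<open>The induction hypothesis of the backward recursion. The bounds give finiteness and thus
  a faithful \<open>J_real\<close>, lower semicontinuity feeds the selection of minimizers, and the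
  identity with \<open>value_fun\<close> turns \<open>J\<close>, an infimum over Markov policies,
  into a lower bound for all policies.\<close>

definition J_regular :: "nat \<Rightarrow> bool" where
  "J_regular n \<longleftrightarrow> (\<forall>h\<in>histories \<M> n. value_fun \<M> n h = J \<M> n (last_state n h)) \<and>
     lsc_on (St \<M>) (J \<M> n) \<and> (\<forall>x\<in>St \<M>. ereal (bl x) \<le> J \<M> n x \<and> J \<M> n x \<le> ereal (bu x))"

lemma J_regular_ereal:
  assumes "J_regular n" "x \<in> St \<M>"
  shows "ereal (J_real \<M> n x) = J \<M> n x"
proof -
  have "ereal (bl x) \<le> J \<M> n x" "J \<M> n x \<le> ereal (bu x)"
    using assms by (auto simp: J_regular_def)
  then show ?thesis
    by (cases "J \<M> n x") (simp_all add: J_real_def)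
qed

lemma J_regular_bounded_lsc:
  assumes "J_regular n"
  shows "bounded_lsc (J_real \<M> n)"
proof -
  have "lsc_on (St \<M>) (\<lambda>x. ereal (J_real \<M> n x))"
    using assms lsc_on_cong[OF J_regular_ereal[OF assms], of "St \<M>"] by (simp add: J_regular_def)
  moreover have "bl x \<le> J_real \<M> n x \<and> J_real \<M> n x \<le> bu x" if "x \<in> St \<M>" for x
  proof -
    have "ereal (bl x) \<le> ereal (J_real \<M> n x)" "ereal (J_real \<M> n x) \<le> ereal (bu x)"
      using assms that unfolding J_regular_ereal[OF assms that] by (simp_all add: J_regular_def)
    then show ?thesis
      by simp
  qed
  ultimately show ?thesis
    by (simp add: bounded_lsc_def lsc_on_ereal_iff)
qed

lemma J_real_le_pol_value:
  assumes "J_regular n" "\<pi> \<in> policies \<M>" "h \<in> histories \<M> n"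
  shows "ereal (J_real \<M> n (last_state n h)) \<le> pol_value \<M> \<pi> n h"
proof -
  have "J \<M> n (last_state n h) = value_fun \<M> n h"
    using assms(1,3) by (simp add: J_regular_def)
  also have "\<dots> \<le> pol_value \<M> \<pi> n h"
    unfolding value_fun_def using assms(2) by (rule INF_lower)
  finally show ?thesis
    by (simp add: J_regular_ereal[OF assms(1) last_state_in_St[OF assms(3)]])
qed

text \<open>A Markov policy attaining a common lower bound \<open>W\<close> of all policies pins the
  infimum over all policies and the one over Markov policies at the same value. The bounds
  \<open>bl\<close> and \<open>bu\<close> are inherited from the attaining policy, so no invariance
  of them under \<open>T_op\<close> has to be shown.\<close>

lemma J_squeeze:
  assumes n: "n \<le> N" and \<pi>: "\<pi> \<in> markov_policies \<M>"
    and lower: "\<And>\<sigma> h. \<sigma> \<in> policies \<M> \<Longrightarrow> h \<in> histories \<M> n \<Longrightarrow> W (last_state n h) \<le> pol_value \<M> \<sigma> n h"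
    and eq: "\<And>h. h \<in> histories \<M> n \<Longrightarrow> pol_value \<M> \<pi> n h = W (last_state n h)"
    and lsc: "lsc_on (St \<M>) W"
  shows "J_regular n" and "\<And>x. x \<in> St \<M> \<Longrightarrow> J \<M> n x = W x"
proof -
  have \<pi>': "\<pi> \<in> policies \<M>"
    using \<pi> markov_policies_subset by blast
  show J: "J \<M> n x = W x" if x: "x \<in> St \<M>" for x
  proof -
    \<comment> \<open>The history chosen inside \<open>markov_value\<close> is the same for every
      policy, so \<open>J\<close> becomes an infimum of policy values at one fixed history.\<close>
    define h where "h = (SOME h. h \<in> histories \<M> n \<and> last_state n h = x)"
    have h: "h \<in> histories \<M> n \<and> last_state n h = x"
      unfolding h_def by (rule someI_ex) (use history_exists[OF x n] in blast)
    have mv: "markov_value \<M> \<sigma> n x = pol_value \<M> \<sigma> n h" for \<sigma>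
      by (simp add: markov_value_def h_def)
    show ?thesis
    proof (rule antisym)
      show "J \<M> n x \<le> W x"
        unfolding J_def mv using eq[of h] h by (intro INF_lower2[OF \<pi>]) simp
      show "W x \<le> J \<M> n x"
        unfolding J_def mv
      proof (rule INF_greatest)
        fix \<sigma> assume "\<sigma> \<in> markov_policies \<M>"
        then show "W x \<le> pol_value \<M> \<sigma> n h"
          using lower[of \<sigma> h] h markov_policies_subset by auto
      qed
    qed
  qed
  have "value_fun \<M> n h = J \<M> n (last_state n h)" if h: "h \<in> histories \<M> n" for h
    unfolding J[OF last_state_in_St[OF h]]
  proof (rule antisym)
    show "value_fun \<M> n h \<le> W (last_state n h)"
      unfolding value_fun_def using eq[OF h] by (intro INF_lower2[OF \<pi>']) simp
    show "W (last_state n h) \<le> value_fun \<M> n h"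
      unfolding value_fun_def using lower h by (intro INF_greatest) auto
  qed
  moreover have "lsc_on (St \<M>) (J \<M> n)"
    using lsc lsc_on_cong[of "St \<M>" "J \<M> n" W] J by simp
  moreover have "ereal (bl x) \<le> J \<M> n x \<and> J \<M> n x \<le> ereal (bu x)" if x: "x \<in> St \<M>" for x
  proof -
    obtain h where h: "h \<in> histories \<M> n" "last_state n h = x"
      using history_exists[OF x n] by blast
    then show ?thesis
      using bounds[OF \<pi>' n h(1)] eq[OF h(1)] J[OF x] by simp
  qed
  ultimately show "J_regular n"
    by (simp add: J_regular_def)
qed

lemma J_horizon:
  shows "J_regular N" and "\<And>x. x \<in> St \<M> \<Longrightarrow> J \<M> N x = ereal (tcost \<M> x)"
proof -
  \<comment> \<open>At the horizon all policies have the same value, so any Markov policy attains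
    the infimum.\<close>
  obtain \<pi> where \<pi>: "\<pi> \<in> markov_policies \<M>"
    using markov_policies_nonempty by blast
  note * = J_squeeze[OF order_refl \<pi>, of "\<lambda>x. ereal (tcost \<M> x)"]
  show "J_regular N" "\<And>x. x \<in> St \<M> \<Longrightarrow> J \<M> N x = ereal (tcost \<M> x)"
    using * by (simp_all add: pol_value_horizon lsc_on_ereal_iff tcost_lsc)
qed

definition minimizer :: "nat \<Rightarrow> ('e \<Rightarrow> 'a) \<Rightarrow> bool" where
  "minimizer n d \<longleftrightarrow> d \<in> markov_rules \<M> n \<and>
     (\<forall>x\<in>St \<M>. T_op \<M> n (J_real \<M> (Suc n)) x = T_rule \<M> n d (J_real \<M> (Suc n)) x)"

text \<open>No Bellman equation at \<open>n\<close> is presupposed, so the lemma serves both to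
  establish it and to evaluate policies of minimizers afterwards.\<close>

lemma pol_value_minimizer_step:
  assumes n: "n < N" and J: "J_regular (Suc n)" and d: "\<And>m. m < N \<Longrightarrow> d m \<in> markov_rules \<M> m"
    and min: "minimizer n (d n)"
    and next_eq: "\<And>h. h \<in> histories \<M> (Suc n) \<Longrightarrow>
      pol_value \<M> (markov_policy d) (Suc n) h = J \<M> (Suc n) (last_state (Suc n) h)"
    and h: "h \<in> histories \<M> n"
  shows "pol_value \<M> (markov_policy d) n h = T_op \<M> n (J_real \<M> (Suc n)) (last_state n h)"
proof -
  have "markov_policy d \<in> policies \<M>"
    using markov_policy_in_markov_policies[of d] d markov_policies_subset by blast
  then have "pol_value \<M> (markov_policy d) n h =
      L_op \<M> n (J_real \<M> (Suc n)) (last_state n h) (markov_policy d n h)"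
    by (rule pol_value_eq_L_op[OF _ n h J_regular_bounded_lsc[OF J]])
      (simp add: next_eq J_regular_ereal[OF J last_state_in_St])
  also have "\<dots> = T_op \<M> n (J_real \<M> (Suc n)) (last_state n h)"
    using min last_state_in_St[OF h] by (simp add: minimizer_def T_rule_def markov_policy_def)
  finally show ?thesis .
qed

text \<open>Regularity and the Bellman equation are hypotheses for the stages from \<open>n\<close>
  on, so that the lemma can be applied at \<open>Suc n\<close> inside the very induction that proves
  them.\<close>

lemma pol_value_minimizers:
  assumes "n \<le> N" and d: "\<And>m. m < N \<Longrightarrow> d m \<in> markov_rules \<M> m"
    and min: "\<And>m. n \<le> m \<Longrightarrow> m < N \<Longrightarrow> minimizer m (d m)"
    and J: "\<And>m. n \<le> m \<Longrightarrow> m < N \<Longrightarrow> J_regular (Suc m)"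
    and bellman: "\<And>m x. n \<le> m \<Longrightarrow> m < N \<Longrightarrow> x \<in> St \<M> \<Longrightarrow> J \<M> m x = T_op \<M> m (J_real \<M> (Suc m)) x"
    and h: "h \<in> histories \<M> n"
  shows "pol_value \<M> (markov_policy d) n h = J \<M> n (last_state n h)"
  using assms(1) min J bellman h
proof (induction n arbitrary: h rule: inc_induct)
  case base
  then show ?case
    by (simp add: pol_value_horizon J_horizon(2) last_state_in_St)
next
  case (step n)
  have "pol_value \<M> (markov_policy d) n h = T_op \<M> n (J_real \<M> (Suc n)) (last_state n h)"
  proof (rule pol_value_minimizer_step[OF step.hyps(2) _ d _ _ step.prems(4)])
    show "pol_value \<M> (markov_policy d) (Suc n) h' = J \<M> (Suc n) (last_state (Suc n) h')"
      if "h' \<in> histories \<M> (Suc n)" for h'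
      by (rule step.IH) (use step.prems(1-3) that in auto)
  qed (use step in auto)
  then show ?case
    using step.prems(3)[of n] step.hyps last_state_in_St[OF step.prems(4)] by simp
qed

text \<open>The attaining policy at \<open>n\<close> consists of minimizers at all later stages, so
  the induction has to carry every stage from \<open>n\<close> to the horizon.\<close>

lemma J_regular_bellman:
  assumes "n \<le> N"
  shows "\<forall>m. n \<le> m \<and> m \<le> N \<longrightarrow>
    J_regular m \<and> (m < N \<longrightarrow> (\<forall>x\<in>St \<M>. J \<M> m x = T_op \<M> m (J_real \<M> (Suc m)) x))"
  using assms
proof (induction n rule: inc_induct)
  case base
  then show ?case
    using J_horizon(1) by auto
next
  case (step n)
  note n = step.hyps(2)
  have J: "J_regular (Suc m)" if "n \<le> m" "m < N" for m
    using step.IH that by simp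
  have bellman: "J \<M> m x = T_op \<M> m (J_real \<M> (Suc m)) x" if "Suc n \<le> m" "m < N" "x \<in> St \<M>" for m x
    using step.IH that by simp
  \<comment> \<open>Before time \<open>n\<close> any rule will do: the value at \<open>n\<close>
    ignores it, but it is needed for \<open>markov_policy d\<close> to be a policy.\<close>
  have "\<exists>f. m < N \<longrightarrow> f \<in> markov_rules \<M> m \<and> (n \<le> m \<longrightarrow> minimizer m f)" for m
  proof (cases "n \<le> m \<and> m < N")
    case True
    then show ?thesis
      using minimizer_exists[OF J_regular_bounded_lsc[OF J]] unfolding minimizer_def by blast
  next
    case False
    then show ?thesis
      using markov_rules_nonempty[of m] by auto
  qed
  then obtain d where d: "\<And>m. m < N \<Longrightarrow> d m \<in> markov_rules \<M> m"
      and min: "\<And>m. n \<le> m \<Longrightarrow> m < N \<Longrightarrow> minimizer m (d m)"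
    by metis
  let ?W = "T_op \<M> n (J_real \<M> (Suc n))"
  have next_eq: "pol_value \<M> (markov_policy d) (Suc n) h = J \<M> (Suc n) (last_state (Suc n) h)"
    if "h \<in> histories \<M> (Suc n)" for h
    by (rule pol_value_minimizers[OF _ d min J bellman that]) (use n in auto)
  have lower: "?W (last_state n h) \<le> pol_value \<M> \<sigma> n h" if "\<sigma> \<in> policies \<M>" "h \<in> histories \<M> n" for \<sigma> h
    by (rule T_op_le_pol_value[OF that(1) n that(2) J_regular_bounded_lsc J_real_le_pol_value])
      (use J n that in auto)
  have eq: "pol_value \<M> (markov_policy d) n h = ?W (last_state n h)" if "h \<in> histories \<M> n" for h
    by (rule pol_value_minimizer_step[OF n J[OF order_refl n] d min[OF order_refl n] next_eq that])
  note squeeze = J_squeeze[OF less_imp_le[OF n] markov_policy_in_markov_policies[OF d] lower eq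
    lsc_on_T_op[OF J_regular_bounded_lsc[OF J[OF order_refl n]] n]]
  show ?case
  proof (intro allI impI)
    fix m assume m: "n \<le> m \<and> m \<le> N"
    show "J_regular m \<and> (m < N \<longrightarrow> (\<forall>x\<in>St \<M>. J \<M> m x = T_op \<M> m (J_real \<M> (Suc m)) x))"
    proof (cases "m = n")
      case True
      then show ?thesis
        using squeeze by simp
    next
      case False
      with m step.IH show ?thesis
        by simp
    qed
  qed
qed

lemma J_regular: "n \<le> N \<Longrightarrow> J_regular n"
  using J_regular_bellman[of n] by simp

lemma bellman_equation:
  "n < N \<Longrightarrow> x \<in> St \<M> \<Longrightarrow> J \<M> n x = T_op \<M> n (J_real \<M> (Suc n)) x"
  using J_regular_bellman[of n] by simp

lemma minimizers_optimal:
  assumes "\<And>n. n < N \<Longrightarrow> minimizer n (d n)" and x: "x \<in> St \<M>"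
  shows "pol_value \<M> (markov_policy d) 0 (init_hist x) =
    (INF \<pi>\<in>policies \<M>. pol_value \<M> \<pi> 0 (init_hist x))"
proof -
  note h = init_hist_in_histories[OF x]
  have "pol_value \<M> (markov_policy d) 0 (init_hist x) = J \<M> 0 x"
    using pol_value_minimizers[OF _ _ _ _ _ h, of d] assms(1) J_regular bellman_equation
    by (simp add: minimizer_def)
  also have "\<dots> = value_fun \<M> 0 (init_hist x)"
    using J_regular[of 0] h unfolding J_regular_def by force
  finally show ?thesis
    by (simp add: value_fun_def)
qed

end

theorem theorem4p7:
  fixes \<M> :: "('w, 'e::polish_space, 'a::polish_space, 'z) model"
    and bl bu :: "'e \<Rightarrow> real" and el eu :: real
  assumes model: "decision_model \<M>"
    and values_measurable:
      "\<And>\<pi> n. \<pi> \<in> policies \<M> \<Longrightarrow> n \<le> horizon \<M> \<Longrightarrow>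
         pol_value \<M> \<pi> n \<in> borel_measurable (hist_space \<M> n)"
    and compact_adm:
      "\<And>n x. n < horizon \<M> \<Longrightarrow> x \<in> St \<M> \<Longrightarrow> compact (adm \<M> n x)"
    and usc_adm:
      "\<And>n xs x as. n < horizon \<M> \<Longrightarrow> (\<And>k. xs k \<in> St \<M>) \<Longrightarrow> x \<in> St \<M> \<Longrightarrow>
         xs \<longlonglongrightarrow> x \<Longrightarrow> (\<And>k. as k \<in> adm \<M> n (xs k)) \<Longrightarrow>
         \<exists>a\<in>adm \<M> n x. accumulation_point as a"
    and trans_continuous:
      "\<And>n z. n < horizon \<M> \<Longrightarrow> z \<in> space (Zsp \<M>) \<Longrightarrow>
         continuous_on (Adm \<M> n) (\<lambda>(x, a). trans_fun \<M> n x a z)"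
    and cost_lsc:
      "\<And>n. n < horizon \<M> \<Longrightarrow> lsc_on (Adm \<M> n \<times> St \<M>) (\<lambda>((x, a), y). cost \<M> n x a y)"
    and tcost_lsc: "lsc_on (St \<M>) (tcost \<M>)"
    and eps: "0 \<le> el" "0 \<le> eu" "el + eu = 1"
    and bl: "bl \<in> borel_measurable (restrict_space borel (St \<M>))" "\<And>x. x \<in> St \<M> \<Longrightarrow> bl x \<le> - el"
    and bu: "bu \<in> borel_measurable (restrict_space borel (St \<M>))" "\<And>x. x \<in> St \<M> \<Longrightarrow> eu \<le> bu x"
    and bounds:
      "\<And>\<pi> n h. \<pi> \<in> policies \<M> \<Longrightarrow> n \<le> horizon \<M> \<Longrightarrow> h \<in> histories \<M> n \<Longrightarrow>
         ereal (bl (last_state n h)) \<le> pol_value \<M> \<pi> n h \<and>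
         pol_value \<M> \<pi> n h \<le> ereal (bu (last_state n h))"
    and local_bounds:
      "\<And>n x' a'. n < horizon \<M> \<Longrightarrow> (x', a') \<in> Adm \<M> n \<Longrightarrow>
         \<exists>\<epsilon>>0. \<exists>\<Theta>1\<in>borel_measurable (Zsp \<M>). \<exists>\<Theta>2\<in>borel_measurable (Zsp \<M>).
           (\<forall>z\<in>space (Zsp \<M>). 0 \<le> \<Theta>1 z \<and> 0 \<le> \<Theta>2 z) \<and>
           (\<lambda>\<omega>. \<Theta>1 (dist_rv \<M> (Suc n) \<omega>)) \<in> Lp (Pr \<M>) (expo \<M>) \<and>
           (\<lambda>\<omega>. \<Theta>2 (dist_rv \<M> (Suc n) \<omega>)) \<in> Lp (Pr \<M>) (expo \<M>) \<and>
           (\<forall>z\<in>space (Zsp \<M>). \<forall>(x, a)\<in>Adm \<M> n \<inter> cball (x', a') \<epsilon>.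
              \<bar>cost \<M> n x a (trans_fun \<M> n x a z)\<bar> \<le> \<Theta>1 z \<and>
              bu (trans_fun \<M> n x a z) - bl (trans_fun \<M> n x a z) \<le> \<Theta>2 z)"
    and risk:
      "\<And>n. n < horizon \<M> \<Longrightarrow>
         monetary (Pr \<M>) (expo \<M>) (risk \<M> n) \<and>
         law_invariant (Pr \<M>) (expo \<M>) (risk \<M> n) \<and>
         fatou_property (Pr \<M>) (expo \<M>) (risk \<M> n)"
  shows
    "(\<forall>n\<le>horizon \<M>.
        (\<forall>h\<in>histories \<M> n. value_fun \<M> n h = J \<M> n (last_state n h)) \<and>
        lsc_on (St \<M>) (J \<M> n) \<and>
        (\<forall>x\<in>St \<M>. ereal (bl x) \<le> J \<M> n x \<and> J \<M> n x \<le> ereal (bu x))) \<and>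
     (\<forall>x\<in>St \<M>. J \<M> (horizon \<M>) x = ereal (tcost \<M> x)) \<and>
     (\<forall>n<horizon \<M>. \<forall>x\<in>St \<M>. J \<M> n x = T_op \<M> n (J_real \<M> (Suc n)) x) \<and>
     (\<forall>n<horizon \<M>. \<exists>d\<in>markov_rules \<M> n. \<forall>x\<in>St \<M>.
        T_op \<M> n (J_real \<M> (Suc n)) x = T_rule \<M> n d (J_real \<M> (Suc n)) x) \<and>
     (\<forall>d. (\<forall>n<horizon \<M>. d n \<in> markov_rules \<M> n \<and>
            (\<forall>x\<in>St \<M>. T_op \<M> n (J_real \<M> (Suc n)) x = T_rule \<M> n (d n) (J_real \<M> (Suc n)) x)) \<longrightarrow>
        markov_policy d \<in> markov_policies \<M> \<and>
        (\<forall>x\<in>St \<M>. pol_value \<M> (markov_policy d) 0 (init_hist x) =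
                    (INF \<pi>\<in>policies \<M>. pol_value \<M> \<pi> 0 (init_hist x))))"
proof -
  interpret risk_decision_model \<M> bl bu el eu
  proof
    show "monetary (Pr \<M>) (expo \<M>) (risk \<M> n) \<and> fatou_property (Pr \<M>) (expo \<M>) (risk \<M> n)"
      if "n < horizon \<M>" for n
      using risk[OF that] by blast
  qed (fact assms)+
  have minimizers: "markov_policy d \<in> markov_policies \<M> \<and>
      (\<forall>x\<in>St \<M>. pol_value \<M> (markov_policy d) 0 (init_hist x) =
        (INF \<pi>\<in>policies \<M>. pol_value \<M> \<pi> 0 (init_hist x)))"
    if "\<forall>n<horizon \<M>. minimizer n (d n)" for d
    using that markov_policy_in_markov_policies[of d] minimizers_optimal[of d]
    by (simp add: minimizer_def)
  show ?thesis
  proof (intro conjI)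
    show "\<forall>n\<le>horizon \<M>.
        (\<forall>h\<in>histories \<M> n. value_fun \<M> n h = J \<M> n (last_state n h)) \<and>
        lsc_on (St \<M>) (J \<M> n) \<and>
        (\<forall>x\<in>St \<M>. ereal (bl x) \<le> J \<M> n x \<and> J \<M> n x \<le> ereal (bu x))"
      using J_regular by (simp add: J_regular_def)
    show "\<forall>x\<in>St \<M>. J \<M> (horizon \<M>) x = ereal (tcost \<M> x)"
      using J_horizon(2) by blast
    show "\<forall>n<horizon \<M>. \<forall>x\<in>St \<M>. J \<M> n x = T_op \<M> n (J_real \<M> (Suc n)) x"
      using bellman_equation by blast
    show "\<forall>n<horizon \<M>. \<exists>d\<in>markov_rules \<M> n. \<forall>x\<in>St \<M>.
        T_op \<M> n (J_real \<M> (Suc n)) x = T_rule \<M> n d (J_real \<M> (Suc n)) x"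
      using minimizer_exists[OF J_regular_bounded_lsc[OF J_regular]] by simp
  qed (use minimizers in \<open>simp add: minimizer_def\<close>)
qed

end
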